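(* Let $d\ge6$. Then there exists a degree $d$ surface in $\mathbb{P}^3$ belonging to $\left(\overline{F(2,2;3)}\setminus F(2,2;3)\right)\cap F(1,3;3)\cap F(1,1;3)$.
   Context: Work over $\mathbb{C}$. For positive integers $i_1,\dots,i_k<d$, $F(i_1,\dots,i_k;n)\subseteq|\mathcal{O}_{\mathbb{P}^n}(d)|$ is the set of degree $d$ hypersurfaces $\{f=0\}$ of $\mathbb{P}^n$ whose equation can be written $f=\sum_{h=1}^k f_hg_h$ with $f_h,g_h$ homogeneous, $\deg f_h=i_h$, $\deg g_h=d-i_h$, and $f_1,\dots,f_k$ a regular sequence (i.e. $\{f_1=\cdots=f_k=0\}$ is a complete intersection of dimension $n-k$). $\overline{F(i_1,\dots,i_k;n)}$ denotes the Zariski closure in $|\mathcal{O}_{\mathbb{P}^n}(d)|$. *)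

theory Defs
  imports Complex_Main "HOL-Library.Poly_Mapping"
begin

text \<open>Polynomials with complex coefficients in variables x_0, x_1, ... :
  a monomial is a finitely supported exponent vector (a poly_mapping from nat to nat),
  a polynomial is a finitely supported map from monomials to coefficients.
  The product on poly_mapping is the convolution product, i.e. polynomial multiplication.\<close>

type_synonym mpoly = "(nat \<Rightarrow>\<^sub>0 nat) \<Rightarrow>\<^sub>0 complex"

definition tdeg :: "('v \<Rightarrow>\<^sub>0 nat) \<Rightarrow> nat" where
  "tdeg m = (\<Sum>i\<in>Poly_Mapping.keys m. Poly_Mapping.lookup m i)"

definition vars_in :: "nat \<Rightarrow> mpoly \<Rightarrow> bool" where
  "vars_in n p \<longleftrightarrow> (\<forall>m\<in>Poly_Mapping.keys p. Poly_Mapping.keys m \<subseteq> {..n})"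

text \<open>Homogeneous of degree e (the zero polynomial is homogeneous of every degree).\<close>
definition homog :: "nat \<Rightarrow> (('v \<Rightarrow>\<^sub>0 nat) \<Rightarrow>\<^sub>0 'a::zero) \<Rightarrow> bool" where
  "homog e p \<longleftrightarrow> (\<forall>m\<in>Poly_Mapping.keys p. tdeg m = e)"

definition form :: "nat \<Rightarrow> nat \<Rightarrow> mpoly \<Rightarrow> bool" where
  "form n e p \<longleftrightarrow> vars_in n p \<and> homog e p"

definition in_ideal :: "nat \<Rightarrow> mpoly list \<Rightarrow> mpoly \<Rightarrow> bool" where
  "in_ideal n fs g \<longleftrightarrow>
     (\<exists>as. length as = length fs \<and> (\<forall>a\<in>set as. vars_in n a) \<and>
           g = (\<Sum>j<length fs. as ! j * fs ! j))"

definition regular_seq :: "nat \<Rightarrow> mpoly list \<Rightarrow> bool" where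
  "regular_seq n fs \<longleftrightarrow>
     (\<forall>f\<in>set fs. vars_in n f) \<and>
     (\<forall>h<length fs. \<forall>g. vars_in n g \<longrightarrow>
         in_ideal n (take h fs) (fs ! h * g) \<longrightarrow> in_ideal n (take h fs) g) \<and>
     \<not> in_ideal n fs 1"

text \<open>F(i_1,...,i_k;n) in |O_{P^n}(d)|, represented by (nonzero) equations f of degree d;
  a hypersurface is the class of f up to nonzero scalars, and membership is scalar invariant.\<close>
definition Fset :: "nat list \<Rightarrow> nat \<Rightarrow> nat \<Rightarrow> mpoly set" where
  "Fset is n d = {f. form n d f \<and> f \<noteq> 0 \<and>
     (\<exists>fs gs. length fs = length is \<and> length gs = length is \<and>
        (\<forall>h<length is. form n (is ! h) (fs ! h) \<and> form n (d - is ! h) (gs ! h)) \<and>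
        f = (\<Sum>h<length is. fs ! h * gs ! h) \<and>
        regular_seq n fs)}"

text \<open>Evaluation of a polynomial in the coefficients (variables indexed by monomials)
  at a coefficient vector c.\<close>
definition coeff_eval :: "(((nat \<Rightarrow>\<^sub>0 nat) \<Rightarrow>\<^sub>0 nat) \<Rightarrow>\<^sub>0 complex) \<Rightarrow> ((nat \<Rightarrow>\<^sub>0 nat) \<Rightarrow> complex) \<Rightarrow> complex" where
  "coeff_eval P c = (\<Sum>\<mu>\<in>Poly_Mapping.keys P. Poly_Mapping.lookup P \<mu> * (\<Prod>v\<in>Poly_Mapping.keys \<mu>. c v ^ Poly_Mapping.lookup \<mu> v))"

text \<open>Zariski closure in the projective space |O_{P^n}(d)|: the closed sets are the common
  zero loci of homogeneous polynomials in the coefficients of the degree d form.\<close>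
definition zar_closure :: "nat \<Rightarrow> nat \<Rightarrow> mpoly set \<Rightarrow> mpoly set" where
  "zar_closure n d S = {f. form n d f \<and> f \<noteq> 0 \<and>
     (\<forall>P e. homog e P \<longrightarrow> (\<forall>g\<in>S. coeff_eval P (Poly_Mapping.lookup g) = 0) \<longrightarrow>
            coeff_eval P (Poly_Mapping.lookup f) = 0)}"

end

(* The surface is f = z y^n + y w^n + w x^n with n = d - 1. It lies in (y, x) and in (y, x^3), and it is the limit of
   the surfaces f - t x^2 y^(n-1), which lie in (y w, y z - t x^2).

   Suppose f = Q1 G1 + Q2 G2 with quadrics Q1, Q2. Write f = z y^n + P and Qi = c z^2 + z l + r with forms in x, y, w.
   If some member of the pencil is monic in z, or the two linear parts l, l' are independent, then elimination of z
   produces a form R of degree 4 or 3 dividing T = l P - r y^n. Comparing T = R U modulo y^2 near the point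
   x = y = 0, where T is either smooth and highly tangent to y = 0 or has such a branch, shows that this is
   impossible. If Q2 does not involve z and l does not divide Q2, the same comparison modulo y^3 forces Q2 to be a
   multiple of l w, a contradiction. In every other case the pencil contains a product of two linear forms in x, y, w
   (a pencil of plane conics has a degenerate member), so that two planes through [0 : 0 : 1 : 0] cut f in a conic
   and a residual curve. This happens only for the planes y = 0 and w = 0, and for these the linear terms of f along
   its lines give a contradiction. *)
theory Submission
  imports Defs "HOL-Computational_Algebra.Computational_Algebra"
begin

subsection \<open>Evaluation homomorphisms\<close>

text \<open>The obstacle is that G1 and G2 may have any degree in z, while f has degree 1 in z. Each
  elimination therefore first bounds the z-degree of the cofactors, by division or by a syzygy; only
  then do the coefficients of z give R U = l P - r y^n. At y = 0 this reads R0 U0 = l0 w x^n. Here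
  l0 is l at y = 0, and b denotes the coefficient of y in l. The coefficient of y on the right, l0
  w^n + b w x^n, forbids R0 and U0 both to vanish along x = 0 to higher order than l0. As R0 has
  degree less than n, all of x^n goes to U0, and R0 divides l0 w, a form of degree 2, which is too
  small for R0. The degree 4 is that of a resultant in z, the degree 3 that of a 2 by 2 determinant;
  the resultant is where n >= 5, that is d >= 6, enters. The name \<open>klein\<close>: putting z =
  x turns f into x y^n + y w^n + w x^n, which for n = 3 is Klein's quartic.\<close>

lemma poly_mapping_eq_sum_single: "p = (\<Sum>m\<in>Poly_Mapping.keys p. Poly_Mapping.single m (Poly_Mapping.lookup p m))"
  by (rule poly_mapping_eqI) (auto simp: lookup_sum lookup_single when_def sum.delta' in_keys_iff)

definition X :: "nat \<Rightarrow> mpoly" where "X i = Poly_Mapping.single (Poly_Mapping.single i 1) 1"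
definition C :: "complex \<Rightarrow> mpoly" where "C c = Poly_Mapping.single 0 c"

definition monom_ev :: "(nat \<Rightarrow> 'a::comm_ring_1) \<Rightarrow> (nat \<Rightarrow>\<^sub>0 nat) \<Rightarrow> 'a" where
  "monom_ev s m = (\<Prod>i\<in>Poly_Mapping.keys m. s i ^ Poly_Mapping.lookup m i)"

text \<open>With \<open>\<iota> = C\<close> this is substitution of polynomials, with the identity
  it is evaluation at a point, and with nested constants it rewrites a polynomial as an iterated
  univariate one. All later restrictions are instances.\<close>

definition ev :: "(complex \<Rightarrow> 'a::comm_ring_1) \<Rightarrow> (nat \<Rightarrow> 'a) \<Rightarrow> mpoly \<Rightarrow> 'a" where
  "ev \<iota> s p = (\<Sum>m\<in>Poly_Mapping.keys p. \<iota> (Poly_Mapping.lookup p m) * monom_ev s m)"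

definition ring_hom :: "('a::comm_ring_1 \<Rightarrow> 'b::comm_ring_1) \<Rightarrow> bool" where
  "ring_hom h \<longleftrightarrow> h 1 = 1 \<and> (\<forall>a b. h (a + b) = h a + h b) \<and> (\<forall>a b. h (a * b) = h a * h b)"

lemma ring_homD:
  assumes "ring_hom h"
  shows "h 1 = 1" "h (a + b) = h a + h b" "h (a * b) = h a * h b" "h 0 = 0" "h (- a) = - h a"
    "h (a - b) = h a - h b" "h (a ^ k) = h a ^ k"
proof -
  show 1: "h 1 = 1" "\<And>a b. h (a + b) = h a + h b" "\<And>a b. h (a * b) = h a * h b"
    using assms by (auto simp: ring_hom_def)
  show 0: "h 0 = 0" using 1(2)[of 0 0] by simp
  show m: "h (- a) = - h a" for a using 1(2)[of a "- a"] 0 by (simp add: eq_neg_iff_add_eq_0 add.commute)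
  show "h (a - b) = h a - h b" using 1(2)[of a "- b"] m by simp
  show "h (a ^ k) = h a ^ k" by (induction k) (simp_all add: 1)
qed

lemma ring_hom_sum: "ring_hom h \<Longrightarrow> h (sum f A) = (\<Sum>a\<in>A. h (f a))"
  by (induction A rule: infinite_finite_induct) (auto simp: ring_homD)

lemma ring_hom_prod: "ring_hom h \<Longrightarrow> h (prod f A) = (\<Prod>a\<in>A. h (f a))"
  by (induction A rule: infinite_finite_induct) (auto simp: ring_homD)

lemma monom_ev_superset:
  assumes "finite A" "Poly_Mapping.keys m \<subseteq> A"
  shows "monom_ev s m = (\<Prod>i\<in>A. s i ^ Poly_Mapping.lookup m i)"
  unfolding monom_ev_def
  by (rule prod.mono_neutral_left) (use assms in \<open>auto simp: in_keys_iff\<close>)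

lemma monom_ev_add: "monom_ev s (m + m') = monom_ev s m * monom_ev s m'"
proof -
  let ?A = "Poly_Mapping.keys m \<union> Poly_Mapping.keys m'"
  have "monom_ev s k = (\<Prod>i\<in>?A. s i ^ Poly_Mapping.lookup k i)" if "k \<in> {m, m', m + m'}" for k
    by (rule monom_ev_superset) (use that Poly_Mapping.keys_add[of m m'] in auto)
  thus ?thesis by (simp add: lookup_add power_add prod.distrib)
qed

lemma ev_superset:
  assumes "ring_hom \<iota>" "finite A" "Poly_Mapping.keys p \<subseteq> A"
  shows "ev \<iota> s p = (\<Sum>m\<in>A. \<iota> (Poly_Mapping.lookup p m) * monom_ev s m)"
  unfolding ev_def
  by (rule sum.mono_neutral_left) (use assms in \<open>auto simp: in_keys_iff ring_homD\<close>)

lemma ev_add: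
  assumes "ring_hom \<iota>"
  shows "ev \<iota> s (p + q) = ev \<iota> s p + ev \<iota> s q"
proof -
  let ?A = "Poly_Mapping.keys p \<union> Poly_Mapping.keys q"
  have "ev \<iota> s r = (\<Sum>m\<in>?A. \<iota> (Poly_Mapping.lookup r m) * monom_ev s m)" if "r \<in> {p, q, p + q}" for r
    by (rule ev_superset) (use assms that Poly_Mapping.keys_add[of p q] in auto)
  thus ?thesis using assms by (simp add: lookup_add ring_homD sum.distrib algebra_simps)
qed

lemma ev_single: "ring_hom \<iota> \<Longrightarrow> ev \<iota> s (Poly_Mapping.single m c) = \<iota> c * monom_ev s m"
  by (cases "c = 0") (auto simp: ev_def ring_homD)

lemma ev_sum: "ring_hom \<iota> \<Longrightarrow> ev \<iota> s (sum f A) = (\<Sum>a\<in>A. ev \<iota> s (f a))"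
  by (induction A rule: infinite_finite_induct) (auto simp: ev_add, auto simp: ev_def)

lemma ev_mult:
  assumes "ring_hom \<iota>"
  shows "ev \<iota> s (p * q) = ev \<iota> s p * ev \<iota> s q"
proof -
  let ?l = "\<lambda>p m. Poly_Mapping.single m (Poly_Mapping.lookup p m)"
  have "p * q = (\<Sum>m\<in>Poly_Mapping.keys p. ?l p m) * (\<Sum>m\<in>Poly_Mapping.keys q. ?l q m)"
    by (metis poly_mapping_eq_sum_single)
  also have "\<dots> = (\<Sum>m\<in>Poly_Mapping.keys p. \<Sum>m'\<in>Poly_Mapping.keys q. Poly_Mapping.single (m + m') (Poly_Mapping.lookup p m * Poly_Mapping.lookup q m'))"
    by (simp add: sum_product mult_single)
  also have "ev \<iota> s \<dots> = (\<Sum>m\<in>Poly_Mapping.keys p. \<iota> (Poly_Mapping.lookup p m) * monom_ev s m) * (\<Sum>m\<in>Poly_Mapping.keys q. \<iota> (Poly_Mapping.lookup q m) * monom_ev s m)"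
    using assms by (simp add: ev_sum ev_single sum_product ring_homD monom_ev_add mult_ac)
  finally show ?thesis by (simp add: ev_def)
qed

lemma ring_hom_ev: "ring_hom \<iota> \<Longrightarrow> ring_hom (ev \<iota> s)"
  by (auto simp: ring_hom_def[of "ev \<iota> s"] ev_add ev_mult)
     (auto simp: ev_def ring_homD monom_ev_def)

lemma ev_C: "ring_hom \<iota> \<Longrightarrow> ev \<iota> s (C c) = \<iota> c"
  by (simp add: C_def ev_single monom_ev_def)

lemma ev_X: "ring_hom \<iota> \<Longrightarrow> ev \<iota> s (X i) = s i"
  by (simp add: X_def ev_single monom_ev_def ring_homD)

lemmas ev_simps = ev_add ev_mult ev_C ev_X
  ring_homD(4-7)[OF ring_hom_ev] ring_homD(1)[OF ring_hom_ev]

lemma ring_hom_comp_ev: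
  assumes "ring_hom h"
  shows "h (ev \<iota> s p) = ev (h \<circ> \<iota>) (h \<circ> s) p"
  by (simp add: ev_def monom_ev_def ring_hom_sum[OF assms] ring_homD[OF assms] ring_hom_prod[OF assms])

lemma ring_hom_C: "ring_hom C"
  by (auto simp: ring_hom_def C_def single_add mult_single)

lemma X_power: "X i ^ k = Poly_Mapping.single (Poly_Mapping.single i k) 1"
  by (induction k) (auto simp: X_def mult_single single_add[symmetric])

lemma prod_single: "finite A \<Longrightarrow> (\<Prod>i\<in>A. Poly_Mapping.single (f i) 1) = (Poly_Mapping.single (\<Sum>i\<in>A. f i) 1 :: mpoly)"
  by (induction A rule: finite_induct) (auto simp: mult_single)

lemma ev_id: "ev C X p = p"
proof -
  have "monom_ev X m = Poly_Mapping.single m 1" for m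
    using poly_mapping_eq_sum_single[of m] by (simp add: monom_ev_def X_power prod_single)
  hence "ev C X p = (\<Sum>m\<in>Poly_Mapping.keys p. Poly_Mapping.single m (Poly_Mapping.lookup p m))"
    by (simp add: ev_def C_def mult_single)
  thus ?thesis using poly_mapping_eq_sum_single[of p] by simp
qed

section \<open>Divisibility through congruent substitutions\<close>

lemma dvd_diff_power: "(a::'a::comm_ring_1) dvd x - y \<Longrightarrow> a dvd x ^ k - y ^ k"
  by (metis dvd_mult2 power_diff_sumr2)

lemma dvd_diff_prod:
  fixes a :: "'a::comm_ring_1"
  assumes "\<And>i. i \<in> A \<Longrightarrow> a dvd f i - g i"
  shows "a dvd prod f A - prod g A"
  using assms
proof (induction A rule: infinite_finite_induct)
  case (insert x A)
  have "prod f (insert x A) - prod g (insert x A) = (f x - g x) * prod f A + g x * (prod f A - prod g A)"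
    using insert by (simp add: algebra_simps)
  thus ?case using insert by (simp add: dvd_add)
qed auto

lemma ev_congruent:
  assumes "\<And>i. a dvd s i - t i"
  shows "a dvd ev \<iota> s p - ev \<iota> t p"
proof -
  have "a dvd monom_ev s m - monom_ev t m" for m
    unfolding monom_ev_def by (intro dvd_diff_prod dvd_diff_power assms)
  moreover have "ev \<iota> s p - ev \<iota> t p = (\<Sum>m\<in>Poly_Mapping.keys p. \<iota> (Poly_Mapping.lookup p m) * (monom_ev s m - monom_ev t m))"
    by (simp add: ev_def sum_subtractf algebra_simps)
  ultimately show ?thesis by (auto intro!: dvd_sum)
qed

text \<open>The substitution \<open>s\<close> is the identity modulo \<open>a\<close> and kills
  \<open>a\<close>, so its kernel is exactly the ideal generated by \<open>a\<close>.\<close>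

lemma dvd_iff_ev_eq_0:
  assumes "ev C s a = 0" "\<And>i. a dvd X i - s i"
  shows "a dvd p \<longleftrightarrow> ev C s p = 0"
proof
  assume "a dvd p"
  thus "ev C s p = 0" using assms(1) by (auto simp: ev_mult ring_hom_C)
next
  assume "ev C s p = 0"
  thus "a dvd p" using ev_congruent[of a X s C p] assms(2) by (simp add: ev_id)
qed

text \<open>Such an \<open>a\<close> generates the kernel of a homomorphism into a domain, and this
  is a prime ideal.\<close>

lemma prime_elem_if_ev:
  assumes "ev C s a = 0" "\<And>i. a dvd X i - s i" "a \<noteq> 0"
  shows "prime_elem a"
  unfolding prime_elem_def using assms(3)
  by (auto simp: dvd_iff_ev_eq_0[OF assms(1,2)] ev_simps ring_hom_C)

lemma prime_elem_X: "prime_elem (X i)" and X_dvd_iff: "X i dvd p \<longleftrightarrow> ev C (X(i := 0)) p = 0"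
proof -
  have 1: "ev C (X(i := 0)) (X i) = 0" by (simp add: ev_X ring_hom_C)
  have 2: "X i dvd X j - (X(i := 0)) j" for j by auto
  have "X i \<noteq> 0" by (simp add: X_def)
       (metis lookup_single_eq lookup_zero zero_neq_one)
  thus "prime_elem (X i)" by (rule prime_elem_if_ev[OF 1 2])
  show "X i dvd p \<longleftrightarrow> ev C (X(i := 0)) p = 0" by (rule dvd_iff_ev_eq_0[OF 1 2])
qed

subsection \<open>Forms and regular sequences\<close>

lemma tdeg_superset:
  assumes "finite A" "Poly_Mapping.keys m \<subseteq> A"
  shows "tdeg m = (\<Sum>i\<in>A. Poly_Mapping.lookup m i)"
  unfolding tdeg_def by (rule sum.mono_neutral_left) (use assms in \<open>auto simp: in_keys_iff\<close>)

lemma tdeg_add: "tdeg (m + m') = tdeg m + tdeg m'"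
proof -
  let ?A = "Poly_Mapping.keys m \<union> Poly_Mapping.keys m'"
  have "tdeg k = (\<Sum>i\<in>?A. Poly_Mapping.lookup k i)" if "k \<in> {m, m', m + m'}" for k
    by (rule tdeg_superset) (use that Poly_Mapping.keys_add[of m m'] in auto)
  thus ?thesis by (simp add: lookup_add sum.distrib)
qed

lemma vars_in_0: "vars_in N 0"
  by (simp add: vars_in_def)

lemma vars_in_add: "vars_in N p \<Longrightarrow> vars_in N q \<Longrightarrow> vars_in N (p + q)"
  using Poly_Mapping.keys_add[of p q] unfolding vars_in_def by blast

lemma vars_in_mult:
  assumes "vars_in N p" "vars_in N q"
  shows "vars_in N (p * q)"
  unfolding vars_in_def
proof
  fix m assume "m \<in> Poly_Mapping.keys (p * q)"
  then obtain a b where "m = a + b" "a \<in> Poly_Mapping.keys p" "b \<in> Poly_Mapping.keys q"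
    using keys_mult[of p q] by auto
  thus "Poly_Mapping.keys m \<subseteq> {..N}"
    using assms Poly_Mapping.keys_add[of a b] unfolding vars_in_def by fastforce
qed

lemma homog_add: "homog e p \<Longrightarrow> homog e q \<Longrightarrow> homog e (p + q :: mpoly)"
  using Poly_Mapping.keys_add[of p q] unfolding homog_def by blast

lemma homog_mult:
  assumes "homog e p" "homog e' q"
  shows "homog (e + e') (p * q :: mpoly)"
  unfolding homog_def
proof
  fix m assume "m \<in> Poly_Mapping.keys (p * q)"
  then obtain a b where "m = a + b" "a \<in> Poly_Mapping.keys p" "b \<in> Poly_Mapping.keys q"
    using keys_mult[of p q] by auto
  thus "tdeg m = e + e'" using assms by (auto simp: homog_def tdeg_add)
qed

lemma vars_in_C: "vars_in N (C c)" and homog_C: "homog 0 (C c)"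
  by (auto simp: vars_in_def C_def homog_def tdeg_def)

lemma vars_in_X: "i \<le> N \<Longrightarrow> vars_in N (X i)" and homog_X: "homog (Suc 0) (X i)"
  by (auto simp: vars_in_def X_def homog_def tdeg_def)

lemma vars_in_uminus: "vars_in N p \<Longrightarrow> vars_in N (- p)"
  and homog_uminus: "homog e p \<Longrightarrow> homog e (- p :: mpoly)"
  by (auto simp: vars_in_def homog_def in_keys_iff)

lemma form_add: "form N e p \<Longrightarrow> form N e q \<Longrightarrow> form N e (p + q)"
  and form_mult: "form N a p \<Longrightarrow> form N b q \<Longrightarrow> form N (a + b) (p * q)"
  and form_uminus: "form N e p \<Longrightarrow> form N e (- p)"
  and form_C: "form N 0 (C c)"
  and form_X: "i \<le> N \<Longrightarrow> form N (Suc 0) (X i)"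
  by (simp_all add: form_def vars_in_add homog_add vars_in_mult homog_mult vars_in_C homog_C
      vars_in_uminus homog_uminus vars_in_X homog_X)

lemma form_diff: "form N e p \<Longrightarrow> form N e q \<Longrightarrow> form N e (p - q)"
  using form_add[OF _ form_uminus] by fastforce

lemma form_smult: "form N e p \<Longrightarrow> form N e (C c * p)"
  using form_mult[OF form_C] by fastforce

lemma form_X_power: "i \<le> N \<Longrightarrow> form N k (X i ^ k)"
proof (induction k)
  case 0
  show ?case using form_C[of N 1] ring_homD(1)[OF ring_hom_C] by simp
next
  case (Suc k)
  thus ?case using form_mult[OF form_X, of i N k "X i ^ k"] by simp
qed

lemma ev_cong_vars:
  assumes "vars_in N p" "\<And>i. i \<le> N \<Longrightarrow> s i = t i"
  shows "ev \<iota> s p = ev \<iota> t p"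
  unfolding ev_def monom_ev_def
  by (intro sum.cong prod.cong refl arg_cong2[of _ _ _ _ "\<lambda>x y. x * y"] arg_cong[of _ _ "\<lambda>x. x ^ _"])
    (use assms in \<open>auto simp: vars_in_def subset_iff\<close>)

lemma vars_in_sum: "(\<And>a. a \<in> A \<Longrightarrow> vars_in N (f a)) \<Longrightarrow> vars_in N (sum f A)"
  by (induction A rule: infinite_finite_induct) (auto simp: vars_in_0 vars_in_add)

lemma vars_in_1: "vars_in N 1"
  by (simp add: vars_in_def)

lemma vars_in_power: "vars_in N p \<Longrightarrow> vars_in N (p ^ k)"
  by (induction k) (auto simp: vars_in_mult vars_in_1)

lemma vars_in_prod: "(\<And>a. a \<in> A \<Longrightarrow> vars_in N (f a)) \<Longrightarrow> vars_in N (prod f A)"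
  by (induction A rule: infinite_finite_induct) (auto simp: vars_in_mult vars_in_1)

lemma vars_in_ev: "(\<And>i. vars_in N (s i)) \<Longrightarrow> vars_in N (ev C s p)"
  unfolding ev_def monom_ev_def by (intro vars_in_sum vars_in_mult vars_in_C vars_in_prod vars_in_power)

section \<open>Principal ideals and regular pairs\<close>

lemma in_ideal_Nil: "in_ideal N [] g \<longleftrightarrow> g = 0"
  by (auto simp: in_ideal_def)

lemma in_ideal_singleton:
  assumes "vars_in N a" "vars_in N g"
  shows "in_ideal N [a] g \<longleftrightarrow> a dvd g"
proof
  assume "in_ideal N [a] g"
  then obtain as where "length as = 1" "g = (\<Sum>j<1. as ! j * [a] ! j)"
    by (auto simp: in_ideal_def)
  thus "a dvd g" by simp
next
  \<comment> \<open>\<open>in_ideal\<close> asks for a cofactor in the variables up to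
    \<open>N\<close>. Setting the other variables to 0 fixes \<open>a\<close> and \<open>g\<close>
    and turns any quotient into such a cofactor.\<close>
  let ?r = "ev C (\<lambda>i. if i \<le> N then X i else 0)"
  have r: "?r p = p" if "vars_in N p" for p
    using ev_cong_vars[OF that, of X "\<lambda>i. if i \<le> N then X i else 0" C] by (simp add: ev_id)
  assume "a dvd g"
  then obtain q where "g = a * q" by auto
  hence "?r g = ?r a * ?r q" by (simp add: ev_mult ring_hom_C)
  hence "g = ?r q * a" using assms by (simp add: r mult.commute)
  moreover have "vars_in N (?r q)" by (rule vars_in_ev) (auto simp: vars_in_X vars_in_0)
  ultimately show "in_ideal N [a] g"
    unfolding in_ideal_def by (intro exI[of _ "[?r q]"]) auto
qed

lemma ring_hom_id: "ring_hom (\<lambda>x. x)"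
  by (simp add: ring_hom_def)

text \<open>The last two assumptions make the ideal proper: both generators vanish at the origin,
  where 1 does not.\<close>

lemma regular_seq_pair:
  assumes "vars_in N a" "vars_in N b" "a \<noteq> 0" "\<And>g. a dvd b * g \<Longrightarrow> a dvd g"
    "ev (\<lambda>x. x) (\<lambda>_. 0) a = 0" "ev (\<lambda>x. x) (\<lambda>_. 0) b = 0"
  shows "regular_seq N [a, b]"
  unfolding regular_seq_def
proof (intro conjI allI impI)
  show "\<forall>f\<in>set [a, b]. vars_in N f" using assms by simp
next
  fix h g assume h: "h < length [a, b]" and g: "vars_in N g"
    and i: "in_ideal N (take h [a, b]) ([a, b] ! h * g)"
  show "in_ideal N (take h [a, b]) g"
    using h i assms(1-3) assms(4)[of g] g
    by (auto simp: less_Suc_eq in_ideal_Nil in_ideal_singleton vars_in_mult)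
next
  show "\<not> in_ideal N [a, b] 1"
  proof
    assume "in_ideal N [a, b] 1"
    then obtain as where "1 = (\<Sum>j<2. as ! j * [a, b] ! j)" by (auto simp: in_ideal_def numeral_2_eq_2)
    hence "1 = as ! 0 * a + as ! 1 * b" by (simp add: numeral_2_eq_2)
    hence "ev (\<lambda>x. x) (\<lambda>_. 0) (1::mpoly) = ev (\<lambda>x. x) (\<lambda>_. 0) (as ! 0 * a + as ! 1 * b)"
      by simp
    also have "\<dots> = 0" using assms(5,6) by (simp add: ev_add ev_mult ring_hom_id)
    finally have "ev (\<lambda>x. x) (\<lambda>_. 0) (1::mpoly) = (0::complex)" .
    thus False using ring_homD(1)[OF ring_hom_ev[OF ring_hom_id]] by simp
  qed
qed

lemma Fset_pairI:
  assumes "form N d f" "f \<noteq> 0" "form N i a" "form N j b" "form N (d - i) g" "form N (d - j) h"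
    "f = a * g + b * h" "regular_seq N [a, b]"
  shows "f \<in> Fset [i, j] N d"
  unfolding Fset_def using assms
  by (intro CollectI conjI exI[of _ "[a, b]"] exI[of _ "[g, h]"]) (auto simp: less_Suc_eq)

lemma lookup_C_mult: "Poly_Mapping.lookup (C t * g) v = t * Poly_Mapping.lookup g v"
  by (simp add: C_def mult_map_scale_conv_mult[symmetric] Poly_Mapping.map.rep_eq when_def)

text \<open>A polynomial condition on coefficient vectors restricts to a continuous function on an affine line.\<close>

lemma zar_closure_line:
  assumes "form N d f" "f \<noteq> 0" "\<And>t. t \<noteq> 0 \<Longrightarrow> f - C t * g \<in> S"
  shows "f \<in> zar_closure N d S"
  unfolding zar_closure_def
proof (intro CollectI conjI allI impI assms(1,2))
  fix P e assume P: "\<forall>g\<in>S. coeff_eval P (Poly_Mapping.lookup g) = 0"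
  define F where "F t = coeff_eval P (Poly_Mapping.lookup (f - C t * g))" for t
  have "F t = 0" if "t \<noteq> 0" for t using P assms(3)[OF that] by (simp add: F_def)
  hence "(F \<longlongrightarrow> 0) (at 0)" by (intro tendsto_eventually) (auto simp: eventually_at_filter)
  moreover have "isCont F 0"
    unfolding F_def coeff_eval_def lookup_minus lookup_C_mult by (intro continuous_intros)
  ultimately have "F 0 = 0" by (metis LIM_unique isCont_def)
  thus "coeff_eval P (Poly_Mapping.lookup f) = 0"
    by (simp add: F_def ring_homD(4)[OF ring_hom_C])
qed

subsection \<open>The surface and its memberships\<close>

lemma power_split: "k \<le> n \<Longrightarrow> x ^ n = x ^ k * x ^ (n - k)" for x :: "'a::comm_ring_1"
  by (simp add: power_add[symmetric])

text \<open>With \<open>x = X 0\<close>, \<open>y = X 1\<close>, \<open>z = X 2\<close>, \<open>w = X 3\<close> this is \<open>z y\<^sup>n + y w\<^sup>n + w x\<^sup>n\<close>.\<close>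

definition klein :: "nat \<Rightarrow> mpoly" where
  "klein n = X 2 * X 1 ^ n + X 1 * X 3 ^ n + X 3 * X 0 ^ n"

lemmas cev_simps = ev_simps[OF ring_hom_id] ev_simps[OF ring_hom_C]

lemma form_klein: "form 3 (Suc n) (klein n)"
  unfolding klein_def
  using form_mult[OF form_X form_X_power, of 2 3 1 n] form_mult[OF form_X form_X_power, of 1 3 3 n]
    form_mult[OF form_X form_X_power, of 3 3 0 n]
  by (intro form_add) auto

text \<open>At [0 : 1 : 0 : 1] only the term y w^n survives. The deformation adds a multiple of x^2,
  so the same point shows that the deformed forms are nonzero.\<close>

lemma ev_klein_at_point:
  assumes "n \<ge> 1"
  shows "ev (\<lambda>x. x) (\<lambda>i. if i = 1 \<or> i = 3 then 1 else 0) (klein n) = 1"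
  using assms by (simp add: klein_def cev_simps)

lemma klein_nonzero: "n \<ge> 1 \<Longrightarrow> klein n \<noteq> 0"
  using ev_klein_at_point[of n] by (auto simp: cev_simps)

lemma regular_seq_X1_X0: "k > 0 \<Longrightarrow> regular_seq 3 [X 1, X 0 ^ k]"
proof (rule regular_seq_pair)
  show "X 1 dvd g" if "X 1 dvd X 0 ^ k * g" for g
    using that by (auto simp: X_dvd_iff cev_simps)
      (metis X_dvd_iff prime_elem_X prime_elem_not_zeroI)
qed (auto simp: vars_in_X vars_in_power cev_simps prime_elem_not_zeroI[OF prime_elem_X])

lemma klein_in_F11: "n \<ge> 1 \<Longrightarrow> klein n \<in> Fset [1, 1] 3 (Suc n)"
proof (rule Fset_pairI[OF form_klein klein_nonzero, where a = "X 1" and b = "X 0"])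
  assume n: "n \<ge> 1"
  have p: "x ^ n = x * x ^ (n - 1)" for x :: mpoly using power_split[of 1 n x] n by simp
  show "klein n = X 1 * (X 2 * X 1 ^ (n - 1) + X 3 ^ n) + X 0 * (X 3 * X 0 ^ (n - 1))"
    unfolding klein_def p[of "X 1"] p[of "X 0"] by (simp add: algebra_simps)
  show "form 3 (Suc n - 1) (X 2 * X 1 ^ (n - 1) + X 3 ^ n)" "form 3 (Suc n - 1) (X 3 * X 0 ^ (n - 1))"
    using form_mult[OF form_X form_X_power, of 2 3 1 "n - 1"] form_X_power[of 3 3 n]
      form_mult[OF form_X form_X_power, of 3 3 0 "n - 1"] n
    by (auto intro!: form_add)
  show "regular_seq 3 [X 1, X 0]" using regular_seq_X1_X0[of 1] by simp
qed (auto simp: form_X)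

lemma klein_in_F13: "n \<ge> 3 \<Longrightarrow> klein n \<in> Fset [1, 3] 3 (Suc n)"
proof (rule Fset_pairI[OF form_klein klein_nonzero, where a = "X 1" and b = "X 0 ^ 3"])
  assume n: "n \<ge> 3"
  have p: "x ^ n = x * x ^ (n - 1)" "x ^ n = x ^ 3 * x ^ (n - 3)" for x :: mpoly
    using power_split[of 1 n x] power_split[of 3 n x] n by simp_all
  show "klein n = X 1 * (X 2 * X 1 ^ (n - 1) + X 3 ^ n) + X 0 ^ 3 * (X 3 * X 0 ^ (n - 3))"
    unfolding klein_def p(1)[of "X 1"] p(2)[of "X 0"] by (simp add: algebra_simps)
  show "form 3 (Suc n - 1) (X 2 * X 1 ^ (n - 1) + X 3 ^ n)" "form 3 (Suc n - 3) (X 3 * X 0 ^ (n - 3))"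
    using form_mult[OF form_X form_X_power, of 2 3 1 "n - 1"] form_X_power[of 3 3 n]
      form_mult[OF form_X form_X_power, of 3 3 0 "n - 3"] n
      Suc_diff_le[OF n]
    by (auto intro!: form_add)
  show "regular_seq 3 [X 1, X 0 ^ 3]" by (rule regular_seq_X1_X0) simp
qed (auto simp: form_X form_X_power)

text \<open>The ideal \<open>(y w, y z, w x\<^sup>2)\<close> of a plane cubic and a line meeting it contains \<open>klein n\<close> and is the limit of
  \<open>(y w, y z - t x\<^sup>2)\<close> as \<open>t\<close> tends to 0, because \<open>z (y w) - w (y z - t x\<^sup>2) = t w x\<^sup>2\<close>.\<close>

lemma deform_identity:
  fixes t t' :: "'a::comm_ring_1"
  assumes "t' * t = 1"
  shows "x2 * (x1 * p) + x1 * (x3 * q) + x3 * (x0\<^sup>2 * r) - t * (x0\<^sup>2 * p)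
    = x1 * x3 * (q + t' * (x2 * r)) + (x1 * x2 - t * x0\<^sup>2) * (p - t' * (x3 * r))"
proof -
  have "x1 * x3 * (q + t' * (x2 * r)) + (x1 * x2 - t * x0\<^sup>2) * (p - t' * (x3 * r))
    = x2 * (x1 * p) + x1 * (x3 * q) + (t' * t) * (x3 * (x0\<^sup>2 * r)) - t * (x0\<^sup>2 * p)"
    by (simp add: algebra_simps)
  thus ?thesis using assms by simp
qed

lemma klein_deform_in_F22:
  assumes "n \<ge> 3" "t \<noteq> 0"
  shows "klein n - C t * (X 0 ^ 2 * X 1 ^ (n - 1)) \<in> Fset [2, 2] 3 (Suc n)"
proof -
  let ?a = "X 1 * X 3" and ?b = "X 1 * X 2 - C t * X 0 ^ 2"
  let ?g = "X 3 ^ (n - 1) + C (1 / t) * (X 2 * X 0 ^ (n - 2))"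
  let ?h = "X 1 ^ (n - 1) - C (1 / t) * (X 3 * X 0 ^ (n - 2))"
  have p: "x ^ n = x * x ^ (n - 1)" "x ^ n = x ^ 2 * x ^ (n - 2)" for x :: mpoly
    using power_split[of 1 n x] power_split[of 2 n x] assms by simp_all
  have t: "C (1 / t) * C t = 1" using assms(2) ring_homD(1,3)[OF ring_hom_C]
    by (metis nonzero_eq_divide_eq)
  have e: "klein n - C t * (X 0 ^ 2 * X 1 ^ (n - 1)) = ?a * ?g + ?b * ?h"
    unfolding klein_def p(1)[of "X 1"] p(1)[of "X 3"] p(2)[of "X 0"] by (rule deform_identity[OF t])
  have f2: "form 3 2 ?a" "form 3 2 ?b"
    using form_mult[OF form_X form_X, of 1 3 3] form_mult[OF form_X form_X, of 1 3 2] form_X_power[of 0 3 2]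
    by (auto intro!: form_diff form_smult simp: numeral_2_eq_2)
  have n1: "Suc (n - 2) = n - 1" using assms(1) by simp
  have f3: "form 3 (n - 1) ?g" "form 3 (n - 1) ?h"
    using form_mult[OF form_X form_X_power, of 2 3 0 "n - 2"] form_X_power[of 3 3 "n - 1"]
      form_X_power[of 1 3 "n - 1"] form_mult[OF form_X form_X_power, of 3 3 0 "n - 2"] assms
    by (auto intro!: form_diff form_add form_smult simp: n1)
  have f: "form 3 (Suc n) (klein n - C t * (X 0 ^ 2 * X 1 ^ (n - 1)))"
    unfolding e using form_mult[OF f2(1) f3(1)] form_mult[OF f2(2) f3(2)] assms by (auto intro!: form_add)
  have "ev (\<lambda>x. x) (\<lambda>i. if i = 1 \<or> i = 3 then 1 else 0) (klein n - C t * (X 0 ^ 2 * X 1 ^ (n - 1))) = 1"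
    using assms ev_klein_at_point[of n] by (simp add: cev_simps)
  hence nz: "klein n - C t * (X 0 ^ 2 * X 1 ^ (n - 1)) \<noteq> 0" by (metis cev_simps(5) zero_neq_one)
  have X0: "X i \<noteq> 0" for i by (rule prime_elem_not_zeroI[OF prime_elem_X])
  \<comment> \<open>\<open>?a\<close> is the product of the primes y and w, and neither divides
    \<open>?b\<close>: modulo y it is - t x^2, and it is free of w and nonzero at [1 : 0 : 0 : 0].
    The two primes are cancelled one after the other.\<close>
  have "regular_seq 3 [?a, ?b]"
  proof (rule regular_seq_pair)
    fix g assume "?a dvd ?b * g"
    hence "X 1 dvd ?b * g" by (rule dvd_mult_left)
    moreover have C: "C t \<noteq> 0" using t by auto
    have "\<not> X 1 dvd ?b" using C X0[of 0] by (simp add: X_dvd_iff cev_simps)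
    ultimately obtain g' where g': "g = X 1 * g'" using prime_elem_dvd_mult_iff[OF prime_elem_X] by blast
    from \<open>?a dvd ?b * g\<close> have "X 1 * X 3 dvd X 1 * (?b * g')" unfolding g' by (simp add: mult_ac)
    hence "X 3 dvd ?b * g'" using X0[of 1] by simp
    moreover have "\<not> X 3 dvd ?b"
    proof
      assume "X 3 dvd ?b"
      hence "ev C (X(3 := 0)) ?b = 0" by (simp add: X_dvd_iff)
      hence "ev (\<lambda>x. x) (\<lambda>i. if i = 0 then 1 else 0) ?b = (0::complex)" by (simp add: cev_simps)
      thus False using assms(2) by (simp add: cev_simps)
    qed
    ultimately have "X 3 dvd g'" using prime_elem_dvd_mult_iff[OF prime_elem_X] by blast
    thus "?a dvd g" unfolding g' by simp
  qed (use f2 X0 in \<open>auto simp: form_def cev_simps\<close>)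
  thus ?thesis using Fset_pairI[OF f nz f2 _ _ e] f3 by simp
qed

lemma klein_in_closure: "n \<ge> 3 \<Longrightarrow> klein n \<in> zar_closure 3 (Suc n) (Fset [2, 2] 3 (Suc n))"
  by (rule zar_closure_line[OF form_klein klein_nonzero klein_deform_in_F22]) auto

subsection \<open>Factors of \<open>l P - r y\<^sup>n\<close>\<close>

definition lin :: "complex \<Rightarrow> complex \<Rightarrow> complex \<Rightarrow> mpoly" where
  "lin a b c = C a * X 0 + C b * X 1 + C c * X 3"

definition quad :: "complex \<Rightarrow> complex \<Rightarrow> complex \<Rightarrow> complex \<Rightarrow> complex \<Rightarrow> complex \<Rightarrow> mpoly" where
  "quad a b c d e g = C a * X 0 ^ 2 + C b * X 1 ^ 2 + C c * X 3 ^ 2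
     + C d * (X 0 * X 1) + C e * (X 0 * X 3) + C g * (X 1 * X 3)"

definition klein0 :: "nat \<Rightarrow> mpoly" where
  "klein0 n = X 1 * X 3 ^ n + X 3 * X 0 ^ n"

text \<open>Orders at 0 add up in a product, and \<open>A\<close> contributes at most
  \<open>k\<close>.\<close>

lemma monom_dvd_mult_cancel:
  fixes A B :: "'a::idom poly"
  assumes "monom 1 (n + k) dvd A * B" "\<not> monom 1 (Suc k) dvd A"
  shows "monom 1 n dvd B"
proof (cases "B = 0")
  case False
  have A: "A \<noteq> 0" using assms(2) by auto
  with False have "A * B \<noteq> 0" by simp
  hence "n + k \<le> order 0 A + order 0 B" using assms(1) by (simp add: monom_1_dvd_iff order_mult)
  moreover have "order 0 A \<le> k" using assms(2) A by (simp add: monom_1_dvd_iff)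
  ultimately show ?thesis using False by (simp add: monom_1_dvd_iff)
qed simp

lemma monom_dvd_mono: "k \<le> n \<Longrightarrow> monom 1 k dvd (monom 1 n :: 'a::comm_ring_1 poly)"
  by (auto simp: monom_1_dvd_iff')

text \<open>\<open>K0, K1\<close> and \<open>U0, U1\<close> are the first two coefficients in \<open>y\<close> of two factors of \<open>l P - r y\<^sup>n\<close>. If both \<open>K0\<close>
  and \<open>U0\<close> vanished to high order along \<open>x = 0\<close>, so would \<open>L * W ^ m\<close>.\<close>

lemma tangent_factor:
  fixes K0 K1 U0 U1 L W E :: "'a::idom poly"
  assumes e0: "K0 * U0 = L * W * monom 1 n"
    and e1: "K0 * U1 + K1 * U0 = L * W ^ m + monom 1 n * E"
    and L: "monom 1 k dvd L" "\<not> monom 1 (Suc k) dvd L"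
    and W: "coeff W 0 \<noteq> 0" and n: "Suc k \<le> n" and K: "degree K0 < n"
  shows "\<exists>U'. U0 = monom 1 n * U' \<and> K0 * U' = L * W"
proof -
  have "monom 1 (n + k) dvd L * monom 1 n"
    using mult_dvd_mono[OF L(1) dvd_refl[of "monom 1 n"]] by (simp add: mult_monom add.commute)
  hence "monom 1 (n + k) dvd W * (L * monom 1 n)" by (rule dvd_mult)
  hence nk: "monom 1 (n + k) dvd K0 * U0" unfolding e0 by (simp add: mult_ac)
  have nz: "K0 * U0 \<noteq> 0" using L(2) W by (auto simp: e0)
  have W0: "\<not> monom 1 (Suc 0) dvd W ^ m" using W
    by (auto simp: monom_1_dvd_iff' Polynomial.coeff_0_power)
  show ?thesis
  proof (cases "monom 1 (Suc k) dvd K0")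
    case False
    from monom_dvd_mult_cancel[OF nk this] obtain U' where U': "U0 = monom 1 n * U'" by auto
    have "monom 1 n * (K0 * U') = monom 1 n * (L * W)" using e0 unfolding U' by (simp add: mult_ac)
    thus ?thesis using U' by simp
  next
    case True
    \<comment> \<open>Otherwise all of \<open>monom 1 n\<close> would divide \<open>K0\<close>,
      whose degree is below \<open>n\<close>.\<close>
    have "monom 1 (Suc k) dvd U0"
    proof (rule ccontr)
      assume "\<not> monom 1 (Suc k) dvd U0"
      hence "monom 1 n dvd K0" using monom_dvd_mult_cancel[of n k U0 K0] nk by (simp add: mult.commute)
      hence "degree (monom (1::'a) n) \<le> degree K0" using nz by (intro dvd_imp_degree_le) auto
      thus False using K by (simp add: degree_monom_eq)
    qed
    with True have "monom 1 (Suc k) dvd L * W ^ m + monom 1 n * E" unfolding e1[symmetric] by simp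
    moreover have "monom 1 (Suc k) dvd monom 1 n * E" by (rule dvd_mult2[OF monom_dvd_mono[OF n]])
    ultimately have "monom 1 (Suc k + 0) dvd W ^ m * L" by (simp add: dvd_add_left_iff mult.commute)
    hence "monom 1 (Suc k) dvd L" by (rule monom_dvd_mult_cancel) (rule W0)
    thus ?thesis using L(2) by simp
  qed
qed

text \<open>Binary forms of degree \<open>k\<close> in \<open>x\<close> (outer variable) and \<open>w\<close> (inner variable) become multiples of \<open>w\<^sup>k\<close> on
  every line \<open>x = a w\<close>; this replaces homogeneity.\<close>

definition wdiv :: "nat \<Rightarrow> complex poly poly \<Rightarrow> bool" where
  "wdiv k F \<longleftrightarrow> (\<forall>a. monom 1 k dvd poly F [:0, a:])"

lemma wdiv_mult: "wdiv k F \<Longrightarrow> wdiv l G \<Longrightarrow> wdiv (k + l) (F * G)"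
  using mult_dvd_mono[of "monom 1 k" _ "monom 1 l"] by (force simp: wdiv_def mult_monom)

lemma wdiv_add: "wdiv k F \<Longrightarrow> wdiv k G \<Longrightarrow> wdiv k (F + G)"
  and wdiv_diff: "wdiv k F \<Longrightarrow> wdiv k G \<Longrightarrow> wdiv k (F - G)"
  by (auto simp: wdiv_def)

abbreviation ww :: "complex poly poly" where "ww \<equiv> [:[:0, 1:]:]"

text \<open>\<open>lin0\<close> and \<open>quad0\<close> are \<open>lin\<close> and
  \<open>quad\<close> at y = 0, with x outside and w inside; they keep the coefficients of the
  monomials free of y.\<close>

definition lin0 :: "complex \<Rightarrow> complex \<Rightarrow> complex poly poly" where
  "lin0 a c = [:[:0, c:], [:a:]:]"

definition quad0 :: "complex \<Rightarrow> complex \<Rightarrow> complex \<Rightarrow> complex poly poly" where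
  "quad0 a c e = [:[:0, 0, c:], [:0, e:], [:a:]:]"

lemma wdiv_lin0: "wdiv 1 (lin0 a c)" and wdiv_quad0: "wdiv 2 (quad0 a c e)"
  by (auto simp: wdiv_def lin0_def quad0_def monom_1_dvd_iff' coeff_pCons less_Suc_eq numeral_2_eq_2)

lemma degree_lin0: "degree (lin0 a c) \<le> 1" and degree_quad0: "degree (quad0 a c e) \<le> 2"
  by (auto simp: lin0_def quad0_def)

lemma lin0_eq_0_iff: "lin0 a c = 0 \<longleftrightarrow> a = 0 \<and> c = 0"
  by (auto simp: lin0_def)

text \<open>On a line x = t w with c + t a nonzero the right side has order exactly 2 in w, but
  \<open>K\<close> has order at least 3.\<close>

lemma wdiv_lin0_contra:
  assumes "K * U = lin0 a c * ww" "wdiv k K" "k \<ge> 3" "lin0 a c \<noteq> 0"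
  shows False
proof -
  obtain t where t: "c + t * a \<noteq> 0"
  proof (cases "c = 0")
    case True thus ?thesis using assms(4) that[of 1] by (auto simp: lin0_eq_0_iff)
  next
    case False thus ?thesis using that[of 0] by auto
  qed
  have "monom 1 k dvd poly (K * U) [:0, t:]" using assms(2) by (simp add: wdiv_def)
  hence "coeff (poly (lin0 a c * ww) [:0, t:]) 2 = 0" using assms(1,3) by (simp add: monom_1_dvd_iff')
  thus False using t by (simp add: lin0_def numeral_2_eq_2 mult.commute)
qed

lemma wdiv_const_contra:
  assumes "K * U = [:[:b:]:] * ww" "wdiv k K" "k \<ge> 2" "b \<noteq> 0"
  shows False
proof -
  have "monom 1 k dvd poly K [:0, 0:]" using assms(2) unfolding wdiv_def by blast
  hence "monom 1 k dvd poly (K * U) [:0, 0:]" by simp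
  hence "\<forall>i<k. coeff (poly ([:[:b:]:] * ww) [:0, 0:]) i = 0"
    unfolding assms(1) by (simp only: monom_1_dvd_iff')
  hence "coeff (poly ([:[:b:]:] * ww) [:0, 0:]) 1 = 0"
    using assms(3) by (auto dest: spec[of _ "Suc 0"])
  thus False using assms(4) by simp
qed

text \<open>The order of \<open>lin0 a c\<close> along x = 0 is 1 if \<open>c = 0\<close> and 0
  otherwise; these are the two values of \<open>k\<close> in \<open>tangent_factor\<close>.\<close>

lemma tangent_lin0:
  assumes "K0 * U0 = lin0 a c * ww * monom 1 n" "K0 * U1 + K1 * U0 = lin0 a c * ww ^ m + monom 1 n * E"
    "lin0 a c \<noteq> 0" "n \<ge> 2" "degree K0 < n"
  shows "\<exists>U'. U0 = monom 1 n * U' \<and> K0 * U' = lin0 a c * ww"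
proof (cases "c = 0")
  case True
  show ?thesis
    by (rule tangent_factor[OF assms(1,2), of 1])
       (use assms True in \<open>auto simp: lin0_def monom_1_dvd_iff' coeff_pCons\<close>)
next
  case False
  show ?thesis
    by (rule tangent_factor[OF assms(1,2), of 0])
       (use assms False in \<open>auto simp: lin0_def monom_1_dvd_iff' coeff_pCons\<close>)
qed

lemma tangent_const:
  assumes "K0 * U0 = [:[:b:]:] * ww * monom 1 n" "K0 * U1 + K1 * U0 = [:[:b:]:] * ww ^ m + monom 1 n * E"
    "b \<noteq> 0" "n \<ge> 2" "degree K0 < n"
  shows "\<exists>U'. U0 = monom 1 n * U' \<and> K0 * U' = [:[:b:]:] * ww"
  by (rule tangent_factor[OF assms(1,2), of 0])
     (use assms in \<open>auto simp: monom_1_dvd_iff' coeff_pCons\<close>)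

text \<open>Setting \<open>z = 0\<close>; the outermost variable of the target is \<open>y\<close>, then \<open>x\<close>, then \<open>w\<close>.\<close>

definition \<psi> :: "mpoly \<Rightarrow> complex poly poly poly" where
  "\<psi> = ev (\<lambda>c. [:[:[:c:]:]:]) (\<lambda>i. if i = 0 then [:[:0, 1:]:] else if i = 1 then [:0, 1:]
     else if i = 3 then [:[:[:0, 1:]:]:] else 0)"

lemma ring_hom_const: "ring_hom h \<Longrightarrow> ring_hom (\<lambda>c. [:h c:])"
  by (simp add: ring_hom_def one_pCons)

lemma ring_hom_\<psi>: "ring_hom \<psi>"
  unfolding \<psi>_def by (intro ring_hom_ev ring_hom_const ring_hom_id)

lemma \<psi>_C: "\<psi> (C c) = [:[:[:c:]:]:]" and \<psi>_X: "\<psi> (X 0) = [:[:0, 1:]:]" "\<psi> (X 1) = [:0, 1:]"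
  "\<psi> (X (Suc 0)) = [:0, 1:]"  "\<psi> (X 3) = [:[:[:0, 1:]:]:]"
  by (simp_all add: \<psi>_def ev_C ev_X ring_hom_const ring_hom_id)

lemma \<psi>_lin: "\<psi> (lin a b c) = [:lin0 a c, [:[:b:]:]:]"
  by (simp add: lin_def ring_homD[OF ring_hom_\<psi>] \<psi>_C \<psi>_X lin0_def)

lemma \<psi>_quad: "\<psi> (quad a b c d e g) = [:quad0 a c e, lin0 d g, [:[:b:]:]:]"
  by (simp add: quad_def ring_homD[OF ring_hom_\<psi>] \<psi>_C \<psi>_X lin0_def quad0_def power2_eq_square)

lemma \<psi>_X1_power: "\<psi> (X 1 ^ n) = monom 1 n"
  by (simp add: ring_homD[OF ring_hom_\<psi>] \<psi>_X monom_altdef)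

lemma const_power: "[:a:] ^ n = [:a ^ n:]" for a :: "'a::comm_ring_1"
  by (induction n) (auto simp: one_pCons)

lemma \<psi>_klein0: "\<psi> (klein0 n) = [:ww * monom 1 n, ww ^ n:]"
  by (simp add: klein0_def ring_homD[OF ring_hom_\<psi>] \<psi>_X const_power monom_altdef mult.commute)

lemma coeff_mult_0: "coeff (p * q) 0 = coeff p 0 * coeff q 0"
  and coeff_mult_1: "coeff (p * q) (Suc 0) = coeff p 0 * coeff q 1 + coeff p 1 * coeff q 0"
  and coeff_mult_2: "coeff (p * q) 2 = coeff p 0 * coeff q 2 + coeff p 1 * coeff q 1 + coeff p 2 * coeff q 0"
  for p q :: "'a::comm_ring_1 poly"
  by (simp_all add: coeff_mult numeral_2_eq_2)

lemma coeff_monom_mult_less: "i < n \<Longrightarrow> coeff (p * monom 1 n) i = 0" for p :: "'a::comm_ring_1 poly"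
  by (metis coeff_monom_mult leD mult.commute)

text \<open>Modulo y^2 the term with \<open>r\<close> disappears. \<open>tangent_lin0\<close> then
  leaves a factor of order at least 3 of a form of degree 2.\<close>

lemma no_factor_lin:
  assumes "K * U = lin a b c * klein0 n - r * X 1 ^ n" "lin0 a c \<noteq> 0"
    "n \<ge> 2" "degree (coeff (\<psi> K) 0) < n" "wdiv k (coeff (\<psi> K) 0)" "k \<ge> 3"
  shows False
proof -
  have e: "\<psi> K * \<psi> U = [:lin0 a c, [:[:b:]:]:] * [:ww * monom 1 n, ww ^ n:] - \<psi> r * monom 1 n"
    using arg_cong[OF assms(1), of \<psi>] \<psi>_X1_power[of n] by (simp add: ring_homD[OF ring_hom_\<psi>] \<psi>_lin \<psi>_klein0)
  have 0: "coeff (\<psi> K) 0 * coeff (\<psi> U) 0 = lin0 a c * ww * monom 1 n"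
    using arg_cong[OF e, of "\<lambda>p. coeff p 0"] assms(3) by (simp add: coeff_mult_0 mult_ac)
  have 1: "coeff (\<psi> K) 0 * coeff (\<psi> U) 1 + coeff (\<psi> K) 1 * coeff (\<psi> U) 0
      = lin0 a c * ww ^ n + monom 1 n * ([:[:b:]:] * ww)"
    using arg_cong[OF e, of "\<lambda>p. coeff p 1"] assms(3)
    by (simp add: coeff_mult_1 coeff_monom_mult_less mult_ac add_ac)
  from tangent_lin0[OF 0 1 assms(2-4)] wdiv_lin0_contra assms(2,5,6) show False by blast
qed

text \<open>The variant for l a multiple of y: after cancelling y the linear form has become the
  constant \<open>b\<close>, and \<open>m\<close> stands for n - 1. It is stated in the target of
  \<open>\<psi>\<close> because the cancellation takes place there. With \<open>Q = 0\<close> it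
  also treats factors of P itself.\<close>

lemma no_factor_const:
  fixes R A Q :: "complex poly poly poly"
  assumes e: "R * A = [:[:[:b:]:]:] * [:ww * monom 1 n, ww ^ n:] - Q * monom 1 m" and b: "b \<noteq> 0"
    and n: "n \<ge> 2" "m \<ge> 2" "degree (coeff R 0) < n" and k: "wdiv k (coeff R 0)" "k \<ge> 2"
  shows False
proof -
  have 0: "coeff R 0 * coeff A 0 = [:[:b:]:] * ww * monom 1 n"
    using arg_cong[OF e, of "\<lambda>p. coeff p 0"] n by (simp add: coeff_mult_0 mult_ac)
  have 1: "coeff R 0 * coeff A 1 + coeff R 1 * coeff A 0 = [:[:b:]:] * ww ^ n + monom 1 n * 0"
    using arg_cong[OF e, of "\<lambda>p. coeff p 1"] n
    by (simp add: coeff_mult_1 coeff_monom_mult_less mult_ac add_ac)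
  from tangent_const[OF 0 1 b n(1,3)] wdiv_const_contra k b show False by blast
qed

subsection \<open>Eliminating \<open>z\<close>\<close>

text \<open>Both halves of homogeneity matter: the degree bound keeps x^n out of a factor, and the
  order in w contradicts a product of too small degree.\<close>

definition hform :: "nat \<Rightarrow> complex poly poly \<Rightarrow> bool" where
  "hform k F \<longleftrightarrow> degree F \<le> k \<and> wdiv k F"

lemma hform_mult: "hform k F \<Longrightarrow> hform l G \<Longrightarrow> hform (k + l) (F * G)"
  using degree_mult_le[of F G] by (auto simp: hform_def wdiv_mult)

lemma hform_add: "hform k F \<Longrightarrow> hform k G \<Longrightarrow> hform k (F + G)"
  and hform_diff: "hform k F \<Longrightarrow> hform k G \<Longrightarrow> hform k (F - G)"
  by (auto simp: hform_def wdiv_add wdiv_diff intro: degree_add_le degree_diff_le)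

lemma hform_lin0: "hform 1 (lin0 a c)" and hform_quad0: "hform 2 (quad0 a c e)"
  using wdiv_lin0 wdiv_quad0 degree_lin0 degree_quad0 by (auto simp: hform_def)

lemma C_mult_inverse: "u \<noteq> 0 \<Longrightarrow> C (1 / u) * C u = 1"
  using ring_homD(1,3)[OF ring_hom_C] by (metis nonzero_eq_divide_eq)

lemma C_dvd_iff: "u \<noteq> 0 \<Longrightarrow> C u * p dvd q \<longleftrightarrow> p dvd q" and dvd_C_iff: "u \<noteq> 0 \<Longrightarrow> p dvd C u * q \<longleftrightarrow> p dvd q"
proof -
  assume u: "u \<noteq> 0"
  have e: "p * k = C u * p * (C (1 / u) * k)" "C u * (p * k) = p * (C u * k)" for k
    proof -
    have "C u * p * (C (1 / u) * k) = (C (1 / u) * C u) * (p * k)" by (simp only: mult_ac)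
    thus "p * k = C u * p * (C (1 / u) * k)" by (simp add: C_mult_inverse[OF u])
  qed (simp only: mult_ac)
  show "C u * p dvd q \<longleftrightarrow> p dvd q"
  proof
    assume "p dvd q"
    then obtain k where "q = p * k" by auto
    thus "C u * p dvd q" using e(1)[of k] by simp
  qed (rule dvd_mult_right)
  have "C (1 / u) * (C u * q) = q" by (simp add: mult.assoc[symmetric] C_mult_inverse[OF u])
  thus "p dvd C u * q \<longleftrightarrow> p dvd q"
    using dvd_mult[of p "C u * q" "C (1 / u)"] dvd_mult[of p q "C u"] by metis
qed

section \<open>Division and elimination in z over a ring of coefficients\<close>

lemma division_by_monic_quadratic:
  fixes G :: "'a::comm_ring_1 poly"
  shows "\<exists>K a b. G = [:r, l, 1:] * K + [:b, a:]"
proof (induction G)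
  case 0
  show ?case by (intro exI[of _ 0]) simp
next
  case (pCons g G)
  then obtain K a b where G: "G = [:r, l, 1:] * K + [:b, a:]" by blast
  show ?case
    \<comment> \<open>Multiplying the remainder a z + b by z produces \<open>a\<close> times the
      divisor and the new remainder (b - a l) z - a r.\<close>
    by (intro exI[of _ "pCons a K"] exI[of _ "b - a * l"] exI[of _ "g - a * r"])
       (simp add: G algebra_simps)
qed

text \<open>Each coefficient of \<open>G\<close> costs one factor \<open>l\<close>, since
  \<open>l\<close> need not be a unit. \<open>prime_power_cancel\<close> removes the power in the
  end.\<close>

lemma pseudo_division_by_linear:
  fixes G :: "'a::comm_ring_1 poly"
  shows "\<exists>m H g. smult (l ^ m) G = [:r, l:] * H + [:g:]"
proof (induction G)
  case 0
  show ?case by (intro exI[of _ 0]) simp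
next
  case (pCons g G)
  then obtain m H h where G: "smult (l ^ m) G = [:r, l:] * H + [:h:]" by blast
  have "smult (l ^ Suc m) (pCons g G) = pCons (l ^ Suc m * g) (smult l (smult (l ^ m) G))" by simp
  also have "\<dots> = [:r, l:] * (smult l (pCons 0 H) + [:h:]) + [:l ^ Suc m * g - r * h:]"
    unfolding G by (simp add: algebra_simps smult_add_right)
  finally show ?case by blast
qed

text \<open>The factor of \<open>a\<close> is the resultant in z of l z + r and z^2 + l' z + r'.
  Reducing \<open>G1\<close> to a z + b makes the other cofactor a constant for degree reasons, and
  \<open>b\<close> is eliminated from the three coefficient equations.\<close>

lemma monic_elimination:
  fixes r l r' l' P Y :: "'a::idom"
  assumes "[:P, Y:] = [:r, l:] * G1 + [:r', l', 1:] * G2"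
  shows "\<exists>a. (r\<^sup>2 - l * l' * r + l\<^sup>2 * r') * a = r * Y - l * P \<and> (l = 0 \<longrightarrow> r dvd P)"
proof -
  obtain K a b where G1: "G1 = [:r', l', 1:] * K + [:b, a:]"
    using division_by_monic_quadratic by blast
  define H where "H = G2 + [:r, l:] * K"
  have e: "[:r', l', 1:] * H = [:P, Y:] - [:r, l:] * [:b, a:]"
    unfolding assms G1 H_def by (simp add: algebra_simps)
  have "degree H = 0"
  proof (cases "H = 0")
    case False
    have "degree ([:r', l', 1:] * H) = 2 + degree H" using False by (subst degree_mult_eq) auto
    moreover have "degree ([:P, Y:] - [:r, l:] * [:b, a:]) \<le> 2"
      by (intro degree_diff_le) (auto intro: order_trans[OF degree_pCons_le] simp: degree_pCons_le)
    ultimately show ?thesis unfolding e by simp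
  qed simp
  then obtain g where "H = [:g:]" by (rule degree_eq_zeroE)
  with e have g: "g = - (l * a)" "l' * g = Y - (r * a + l * b)" "r' * g = P - r * b"
    by (auto simp: algebra_simps)
  have Y: "Y = l' * g + (r * a + l * b)" and P: "P = r' * g + r * b" using g(2,3) by simp_all
  have "(r\<^sup>2 - l * l' * r + l\<^sup>2 * r') * a = r * Y - l * P"
    unfolding Y P g(1) by (simp add: algebra_simps power2_eq_square)
  moreover have "l = 0 \<longrightarrow> r dvd P" using g by auto
  ultimately show ?thesis by blast
qed

text \<open>The top coefficients of \<open>G1\<close> and \<open>G2\<close> form a syzygy of
  \<open>l\<close> and \<open>l'\<close>, which is a multiple of the trivial one. Subtracting the
  same multiple of the trivial syzygy of the two linear polynomials lowers both degrees.\<close>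

lemma syzygy_descent:
  fixes P Y r l r' l' :: "'a::idom"
  assumes syz: "\<And>u v. l * u + l' * v = 0 \<Longrightarrow> \<exists>k. u = l' * k \<and> v = - (l * k)"
  assumes "[:P, Y:] = [:r, l:] * G1 + [:r', l':] * G2" "degree G1 \<le> m" "degree G2 \<le> m"
  shows "\<exists>g1 g2. [:P, Y:] = [:r, l:] * [:g1:] + [:r', l':] * [:g2:]"
  using assms(2-)
proof (induction m arbitrary: G1 G2)
  case 0
  hence "degree G1 = 0" "degree G2 = 0" by auto
  then obtain g1 g2 where "G1 = [:g1:]" "G2 = [:g2:]" by (metis degree_eq_zeroE)
  thus ?case using 0 by blast
next
  case (Suc m)
  have c: "coeff ([:r, l:] * G) (Suc i) = r * coeff G (Suc i) + l * coeff G i" for r l :: 'a and G i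
    by (simp add: mult_pCons_left)
  have koszul: "A * G1 + B * G2 = A * (G1 - M * B) + B * (G2 + M * A)" for A B M :: "'a poly"
    by (simp add: algebra_simps)
  have z: "coeff G1 (Suc (Suc m)) = 0" "coeff G2 (Suc (Suc m)) = 0"
    using Suc.prems by (auto intro: coeff_eq_0)
  \<comment> \<open>The left side has degree at most 1 in z, so the coefficient of index m + 2
    contains only the top coefficients.\<close>
  have "coeff [:P, Y:] (Suc (Suc m)) = 0" by simp
  hence "l * coeff G1 (Suc m) + l' * coeff G2 (Suc m) = 0"
    unfolding Suc.prems(1) coeff_add c z by simp
  from syz[OF this] obtain k where k: "coeff G1 (Suc m) = l' * k" "coeff G2 (Suc m) = - (l * k)" by blast
  have "[:P, Y:] = [:r, l:] * (G1 - monom k m * [:r', l':]) + [:r', l':] * (G2 + monom k m * [:r, l:])"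
    unfolding Suc.prems(1) by (rule koszul)
  moreover have "degree (G - monom c m * [:a, b:]) \<le> m"
    if "degree G \<le> Suc m" "coeff G (Suc m) = c * b" for G c and a b :: 'a
  proof (rule degree_le, intro allI impI)
    fix i assume "m < i"
    then consider "i = Suc m" | "Suc m < i" by linarith
    thus "coeff (G - monom c m * [:a, b:]) i = 0"
    proof cases
      case 1
      thus ?thesis using that by (simp add: coeff_monom_mult)
    next
      case 2
      hence "coeff [:a, b:] (i - m) = 0" by (intro coeff_eq_0) auto
      moreover have "coeff (monom c m * [:a, b:]) i = c * coeff [:a, b:] (i - m)"
        using 2 by (subst coeff_monom_mult) simp
      moreover have "coeff G i = 0" using 2 that(1) by (intro coeff_eq_0) simp
      ultimately show ?thesis by (simp only: coeff_diff) simp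
    qed
  qed
  from this[OF Suc.prems(2), of k l' r'] this[OF Suc.prems(3), of "- k" l r] k
  have "degree (G1 - monom k m * [:r', l':]) \<le> m" "degree (G2 + monom k m * [:r, l:]) \<le> m"
    unfolding minus_monom[symmetric] mult_minus_left diff_minus_eq_add by (simp_all only: mult.commute minus_mult_left)
  ultimately show ?case by (rule Suc.IH)
qed

subsection \<open>Pencils without a conic in a plane\<close>

lemma lin_eq_0_iff: "lin a b c = 0 \<longleftrightarrow> a = 0 \<and> b = 0 \<and> c = 0"
proof
  assume l: "lin a b c = 0"
  have "ev (\<lambda>x. x) s (lin a b c) = 0" for s :: "nat \<Rightarrow> complex" unfolding l by (simp add: cev_simps)
  hence "a * s 0 + b * s 1 + c * s 3 = 0" for s :: "nat \<Rightarrow> complex" by (simp add: lin_def cev_simps)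
  from this[of "\<lambda>i. if i = 0 then 1 else 0"] this[of "\<lambda>i. if i = 1 then 1 else 0"]
    this[of "\<lambda>i. if i = 3 then 1 else 0"]
  show "a = 0 \<and> b = 0 \<and> c = 0" by simp
qed (simp add: lin_def ring_homD[OF ring_hom_C])

text \<open>Solving p = 0 for \<open>X j\<close> gives the substitution \<open>?s\<close>, which
  kills \<open>p\<close> and is the identity modulo \<open>p\<close>; the third assumption says that
  \<open>q\<close> is free of \<open>X j\<close>.\<close>

lemma prime_elem_linear:
  assumes u: "u \<noteq> 0" and p: "p = C u * X j + q" and q: "\<And>t. ev C (X(j := t)) q = q"
    and nz: "p \<noteq> 0"
  shows "prime_elem p"
proof (rule prime_elem_if_ev[OF _ _ nz])
  let ?s = "X(j := X j - C (1 / u) * p)"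
  have "ev C ?s p = C u * X j - (C (1 / u) * C u) * p + q"
    unfolding p by (simp add: cev_simps q) (simp add: algebra_simps)
  thus "ev C ?s p = 0" using C_mult_inverse[OF u] by (simp add: p)
  show "p dvd X i - ?s i" for i by simp
qed

lemma prime_elem_lin:
  assumes "lin a b c \<noteq> 0"
  shows "prime_elem (lin a b c)"
proof -
  consider "a \<noteq> 0" | "b \<noteq> 0" | "c \<noteq> 0" using assms by (auto simp: lin_eq_0_iff)
  thus ?thesis
  proof cases
    case 1
    show ?thesis
      by (rule prime_elem_linear[OF 1 _ _ assms, of 0 "C b * X 1 + C c * X 3"]) (simp_all add: lin_def cev_simps)
  next
    case 2
    show ?thesis
      by (rule prime_elem_linear[OF 2 _ _ assms, of 1 "C a * X 0 + C c * X 3"]) (simp_all add: lin_def cev_simps)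
  next
    case 3
    show ?thesis
      by (rule prime_elem_linear[OF 3 _ _ assms, of 3 "C a * X 0 + C b * X 1"]) (simp_all add: lin_def cev_simps)
  qed
qed

text \<open>The second form vanishes wherever the first does; three points of that plane give the
  three minors.\<close>

lemma lin_dvd_lin:
  assumes "lin a b c dvd lin a' b' c'"
  shows "a * b' = a' * b" "a * c' = a' * c" "b * c' = b' * c"
proof -
  obtain k where k: "lin a' b' c' = lin a b c * k" using assms by auto
  have z: "a' * s 0 + b' * s 1 + c' * s 3 = 0" if "a * s 0 + b * s 1 + c * s 3 = 0" for s :: "nat \<Rightarrow> complex"
  proof -
    have "ev (\<lambda>x. x) s (lin a' b' c') = ev (\<lambda>x. x) s (lin a b c) * ev (\<lambda>x. x) s k"
      unfolding k by (simp add: cev_simps)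
    thus ?thesis using that by (simp add: lin_def cev_simps)
  qed
  from z[of "\<lambda>i. if i = 0 then b else if i = 1 then - a else 0"]
  show "a * b' = a' * b" by (simp add: mult.commute)
  from z[of "\<lambda>i. if i = 0 then c else if i = 3 then - a else 0"]
  show "a * c' = a' * c" by (simp add: mult.commute)
  from z[of "\<lambda>i. if i = 1 then c else if i = 3 then - b else 0"]
  show "b * c' = b' * c" by (simp add: mult.commute)
qed

lemma prime_power_cancel:
  assumes "prime_elem p" "\<not> p dvd a" "p ^ m * t = a * v"
  shows "a dvd (t :: 'a::idom)"
  using assms(3)
proof (induction m arbitrary: v)
  case (Suc m)
  have "p dvd a * v" using Suc.prems by (metis dvd_triv_left power_Suc mult.assoc)
  then obtain w where w: "v = p * w" using assms(1,2) by (auto simp: prime_elem_dvd_mult_iff)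
  have "p * (p ^ m * t) = p * (a * w)" using Suc.prems w by (simp add: mult_ac)
  hence "p ^ m * t = a * w" using assms(1) by (simp add: prime_elem_not_zeroI)
  thus ?case by (rule Suc.IH)
qed simp

lemma \<psi>_0: "coeff (\<psi> (lin a b c)) 0 = lin0 a c" "coeff (\<psi> (quad a b c d e g)) 0 = quad0 a c e"
  by (simp_all add: \<psi>_lin \<psi>_quad)

text \<open>At y = 0 the resultant \<open>?R\<close> is a quartic, so n >= 5 keeps its degree below
  n. The cases are: l not a multiple of y, l = 0 (then r divides P), and l = q y.\<close>

lemma not_monic_elimination:
  assumes e: "[:klein0 n, X 1 ^ n:] = [:r, l:] * G1 + [:r', l', 1:] * G2" and n: "n \<ge> 5"
    and r: "r = quad a b c d e' g" and l: "l = lin p q s"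
    and r': "r' = quad a' b' c' d' e'' g'" and l': "l' = lin p' q' s'"
  shows False
proof -
  let ?R = "r\<^sup>2 - l * l' * r + l\<^sup>2 * r'"
  obtain A where A: "?R * A = r * X 1 ^ n - l * klein0 n" and l0: "l = 0 \<Longrightarrow> r dvd klein0 n"
    using monic_elimination[OF e] by blast
  define R0 where "R0 = coeff (\<psi> ?R) 0"
  have R0: "R0 = (quad0 a c e')\<^sup>2 - lin0 p s * lin0 p' s' * quad0 a c e' + (lin0 p s)\<^sup>2 * quad0 a' c' e''"
    unfolding R0_def r l r' l' by (simp add: ring_homD[OF ring_hom_\<psi>] coeff_mult_0 power2_eq_square \<psi>_0)
  have "hform 4 R0"
    unfolding R0 power2_eq_square
    using hform_mult[OF hform_quad0[of a c e'] hform_quad0[of a c e']]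
      hform_mult[OF hform_mult[OF hform_lin0[of p s] hform_lin0[of p' s']] hform_quad0[of a c e']]
      hform_mult[OF hform_mult[OF hform_lin0[of p s] hform_lin0[of p s]] hform_quad0[of a' c' e'']]
    by (intro hform_add hform_diff) (simp_all add: eval_nat_numeral)
  hence deg: "degree R0 < n" and wd: "wdiv 4 R0" using n by (auto simp: hform_def)
  show False
  proof (cases "lin0 p s = 0")
    case False
    have "?R * (- A) = lin p q s * klein0 n - r * X 1 ^ n" using A l by (simp add: algebra_simps)
    from no_factor_lin[OF this False _ deg[unfolded R0_def] wd[unfolded R0_def]] n show False by simp
  next
    case True
    hence ps: "p = 0" "s = 0" by (auto simp: lin0_eq_0_iff)
    have \<psi>l: "\<psi> l = [:0, [:[:q:]:]:]" unfolding l ps by (simp add: \<psi>_lin lin0_def)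
    show False
    proof (cases "q = 0")
      case True
      have "l = 0" unfolding l ps True by (simp add: lin_eq_0_iff)
      from l0[OF this] obtain V where V: "klein0 n = r * V" by auto
      have "\<psi> r * \<psi> V = [:[:[:1:]:]:] * [:ww * monom 1 n, ww ^ n:] - 0 * monom 1 2"
        using arg_cong[OF V, of \<psi>] by (simp add: \<psi>_klein0 ring_homD[OF ring_hom_\<psi>] one_pCons[symmetric])
      thus False
        by (rule no_factor_const)
           (use n in \<open>auto simp: r \<psi>_0 wdiv_quad0 intro: le_less_trans[OF degree_quad0] wdiv_quad0\<close>)
    next
      case False
      define RR AA where "RR = \<psi> ?R" and "AA = \<psi> A"
      have n1: "monom 1 n = [:0, 1:] * (monom 1 (n - 1) :: complex poly poly poly)"
        using n by (cases n) (simp_all add: monom_Suc)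
      have "RR * AA = \<psi> r * \<psi> (X 1 ^ n) - \<psi> l * \<psi> (klein0 n)"
        unfolding RR_def AA_def using arg_cong[OF A, of \<psi>] by (simp only: ring_homD[OF ring_hom_\<psi>])
      also have "\<dots> = [:0, 1:] * (\<psi> r * monom 1 (n - 1) - [:[:[:q:]:]:] * [:ww * monom 1 n, ww ^ n:])"
        unfolding \<psi>_X1_power \<psi>l \<psi>_klein0 n1[symmetric] by (simp add: n1 algebra_simps)
      finally have e: "RR * AA = [:0, 1:] * (\<psi> r * monom 1 (n - 1) - [:[:[:q:]:]:] * [:ww * monom 1 n, ww ^ n:])" .
      have 1: "coeff RR 0 * coeff AA 1 + coeff RR 1 * coeff AA 0 = - ([:[:q:]:] * ww * monom 1 n)"
        using arg_cong[OF e, of "\<lambda>p. coeff p 1"] n by (simp add: coeff_mult_1 coeff_monom_mult_less mult_ac add_ac)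
      have "coeff RR 0 * coeff AA 0 = 0"
        using arg_cong[OF e, of "\<lambda>p. coeff p 0"] by (simp add: coeff_mult_0)
      \<comment> \<open>Modulo y the resultant is r^2. If it vanished there, r would be divisible by
        y and \<open>RR\<close> by y^2, against the nonzero coefficient in \<open>1\<close>. So the
        factor y belongs to \<open>AA\<close>.\<close>
      moreover have False if "coeff RR 0 = 0"
      proof -
        have "coeff (\<psi> r) 0 = 0" using that unfolding RR_def
          by (simp add: ring_homD[OF ring_hom_\<psi>] \<psi>l coeff_mult_0 power2_eq_square)
        hence "coeff RR 1 = 0" unfolding RR_def
          by (simp add: ring_homD[OF ring_hom_\<psi>] \<psi>l coeff_mult_1 coeff_mult_0 power2_eq_square)
        thus False using 1 that False by simp
      qed
      ultimately have "coeff AA 0 = 0" and nz: "coeff RR 0 \<noteq> 0" by auto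
      then obtain B where B: "AA = [:0, 1:] * B" by (cases AA) auto
      have "[:0, 1:] * (RR * (- B)) = [:0, 1:] * ([:[:[:q:]:]:] * [:ww * monom 1 n, ww ^ n:] - \<psi> r * monom 1 (n - 1))"
        using e unfolding B by (simp add: algebra_simps)
      hence "RR * (- B) = [:[:[:q:]:]:] * [:ww * monom 1 n, ww ^ n:] - \<psi> r * monom 1 (n - 1)"
        by (metis mult_cancel_left pCons_eq_0_iff zero_neq_one)
      thus False
        by (rule no_factor_const[where k = 4]) (use False n deg wd in \<open>auto simp: RR_def R0_def\<close>)
    qed
  qed
qed

text \<open>As \<open>l\<close> is prime and does not divide \<open>l'\<close>, all syzygies are
  trivial and the cofactors become free of z. Cramer's rule then makes the cubic l r' - l' r a
  factor of l P - r y^n.\<close>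

lemma not_linear_pencil:
  assumes e: "[:klein0 n, X 1 ^ n:] = [:r, l:] * G1 + [:r', l':] * G2" and n: "n \<ge> 4"
    and r: "r = quad a b c d e' g" and l: "l = lin p q s"
    and r': "r' = quad a' b' c' d' e'' g'" and l': "l' = lin p' q' s'"
    and indep: "\<not> l dvd l'" "lin0 p s \<noteq> 0"
  shows False
proof -
  have "l \<noteq> 0" using indep(2) by (auto simp: l lin_eq_0_iff lin0_eq_0_iff)
  hence prime: "prime_elem l" unfolding l by (rule prime_elem_lin)
  have "\<exists>k. u = l' * k \<and> v = - (l * k)" if uv: "l * u + l' * v = 0" for u v
  proof -
    have "l' * v = l * (- u)" using uv by (simp add: add_eq_0_iff)
    hence "l dvd l' * v" by (metis dvd_triv_left)
    then obtain w where w: "v = l * w" using prime indep(1) by (auto simp: prime_elem_dvd_mult_iff)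
    have "l * (u + l' * w) = 0" using uv w by (simp add: algebra_simps)
    hence "u = l' * (- w)" using \<open>l \<noteq> 0\<close> by (simp add: add_eq_0_iff)
    thus ?thesis using w by (intro exI[of _ "- w"]) simp
  qed
  from syzygy_descent[OF this e max.cobounded1 max.cobounded2] obtain g1 g2
    where g: "[:klein0 n, X 1 ^ n:] = [:r, l:] * [:g1:] + [:r', l':] * [:g2:]" by blast
  have P: "klein0 n = r * g1 + r' * g2" and Y: "X 1 ^ n = l * g1 + l' * g2"
    using g by (simp_all add: mult.commute)
  let ?R = "l * r' - l' * r"
  have "?R * g2 = l * klein0 n - r * X 1 ^ n" unfolding P Y by (simp add: algebra_simps)
  hence "?R * g2 = lin p q s * klein0 n - r * X 1 ^ n" by (simp add: l)
  moreover have R0: "coeff (\<psi> ?R) 0 = lin0 p s * quad0 a' c' e'' - lin0 p' s' * quad0 a c e'"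
    unfolding r l r' l' by (simp add: ring_homD[OF ring_hom_\<psi>] coeff_mult_0 \<psi>_0)
  have "hform 3 (coeff (\<psi> ?R) 0)"
    unfolding R0 using hform_mult[OF hform_lin0[of p s] hform_quad0[of a' c' e'']]
      hform_mult[OF hform_lin0[of p' s'] hform_quad0[of a c e']]
    by (intro hform_diff) (simp_all add: eval_nat_numeral)
  hence "degree (coeff (\<psi> ?R) 0) < n" "wdiv 3 (coeff (\<psi> ?R) 0)" using n by (auto simp: hform_def)
  ultimately show False using no_factor_lin indep(2) n by fastforce
qed

text \<open>After pseudo-division of \<open>G2\<close> the cofactor of r + l z is a constant h by
  degree. Eliminating h from the equations for r h and l h gives the claim.\<close>

lemma const_elimination:
  fixes P Y r l \<rho> :: "'a::idom"
  assumes "[:P, Y:] = [:r, l:] * G1 + [:\<rho>:] * G2" and l: "l \<noteq> 0"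
  shows "\<exists>m v. l ^ m * (l * P - r * Y) = \<rho> * v"
proof -
  obtain m H g where G2: "smult (l ^ m) G2 = [:r, l:] * H + [:g:]" using pseudo_division_by_linear by blast
  have e: "smult (l ^ m) [:P, Y:] = [:r, l:] * smult (l ^ m) G1 + [:\<rho>:] * smult (l ^ m) G2"
    unfolding assms(1) by (simp add: smult_add_right mult_ac)
  have "[:r, l:] * (smult (l ^ m) G1 + [:\<rho>:] * H) = [:l ^ m * P - \<rho> * g, l ^ m * Y:]"
  proof -
    have "[:l ^ m * P - \<rho> * g, l ^ m * Y:] = smult (l ^ m) [:P, Y:] - [:\<rho>:] * [:g:]" by simp
    also have "\<dots> = [:r, l:] * (smult (l ^ m) G1 + [:\<rho>:] * H)"
      unfolding e G2 by (simp only: algebra_simps)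
    finally show ?thesis ..
  qed
  then obtain H' where H': "[:r, l:] * H' = [:l ^ m * P - \<rho> * g, l ^ m * Y:]" by blast
  have "degree H' = 0"
  proof (cases "H' = 0")
    case False
    have "degree ([:r, l:] * H') = 1 + degree H'" using False l by (subst degree_mult_eq) auto
    moreover have "degree [:l ^ m * P - \<rho> * g, l ^ m * Y:] \<le> 1" by simp
    ultimately show ?thesis unfolding H' by simp
  qed simp
  then obtain h where "H' = [:h:]" by (rule degree_eq_zeroE)
  with H' have "r * h = l ^ m * P - \<rho> * g" "l * h = l ^ m * Y" by (simp_all add: mult.commute)
  moreover have "l * (r * h) = r * (l * h)" by (simp add: mult_ac)
  ultimately have "l * (l ^ m * P - \<rho> * g) = r * (l ^ m * Y)" by simp
  hence "l ^ m * (l * P - r * Y) = \<rho> * (l * g)" by (simp add: algebra_simps)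
  thus ?thesis by blast
qed

lemma quad0_eq_0_iff: "quad0 a c e = 0 \<longleftrightarrow> a = 0 \<and> c = 0 \<and> e = 0"
  by (auto simp: quad0_def)

lemma coeff_ww_mult: "poly (coeff (ww * F) i) 0 = 0"
  by simp

lemma quad_mult_C: "C u * quad a b c d e g = quad (u * a) (u * b) (u * c) (u * d) (u * e) (u * g)"
  by (simp add: quad_def ring_homD[OF ring_hom_C] algebra_simps)

lemma lin_mult_X3: "lin a b c * X 3 = quad 0 0 c 0 a b"
  by (simp add: quad_def lin_def ring_homD[OF ring_hom_C] algebra_simps power2_eq_square)

text \<open>At y = 0 the conic equals l w; the conclusion says that it equals l w identically,
  compare \<open>lin_mult_X3\<close>. The coefficients of 1, y and y^2 are compared, none of which
  meets r y^n because n >= 3.\<close>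

lemma conic_factor_normalised:
  assumes e: "quad 0 B c D a G * U = lin a b c * klein0 n - r * X 1 ^ n" and l0: "lin0 a c \<noteq> 0" and n: "n \<ge> 3"
  shows "D = 0 \<and> B = 0 \<and> G = b"
proof -
  define V where "V i = coeff (\<psi> U) i" for i
  let ?x = "monom 1 n :: complex poly poly"
  have e': "[:quad0 0 c a, lin0 D G, [:[:B:]:]:] * \<psi> U = [:lin0 a c, [:[:b:]:]:] * [:ww * ?x, ww ^ n:] - \<psi> r * monom 1 n"
    using arg_cong[OF e, of \<psi>] \<psi>_X1_power[of n] by (simp add: ring_homD[OF ring_hom_\<psi>] \<psi>_lin \<psi>_klein0 \<psi>_quad)
  have q: "quad0 0 c a = lin0 a c * ww" by (simp add: quad0_def lin0_def)
  obtain k where k: "n = Suc k" "k \<ge> 2" using n by (cases n) auto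
  have w: "ww ^ n = ww * ww ^ k" using k by simp
  have "lin0 a c * ww * V 0 = lin0 a c * ww * ?x"
    using arg_cong[OF e', of "\<lambda>p. coeff p 0"] n unfolding V_def[symmetric] coeff_mult_0 q
    by (simp add: coeff_mult_0 V_def mult_ac)
  hence V0: "V 0 = ?x" using l0 by (simp only: mult_cancel_left mult_eq_0_iff) simp
  have "lin0 a c * ww * V 1 + lin0 D G * V 0 = lin0 a c * ww ^ n + [:[:b:]:] * ww * ?x"
    using arg_cong[OF e', of "\<lambda>p. coeff p 1"] n
    by (simp add: coeff_mult_1 q V_def coeff_monom_mult_less mult_ac add_ac)
  hence 1: "lin0 D G * ?x = ww * (lin0 a c * ww ^ k + [:[:b:]:] * ?x - lin0 a c * V 1)"
    unfolding V0 w by (simp only: algebra_simps)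
  have "lin0 a c * ww * V 2 + lin0 D G * V 1 + [:[:B:]:] * V 0 = [:[:b:]:] * ww ^ n"
    using arg_cong[OF e', of "\<lambda>p. coeff p 2"] n
    by (simp add: coeff_mult_2 q V_def coeff_monom_mult_less mult_ac add_ac numeral_2_eq_2)
  hence 2: "[:[:B:]:] * ?x = [:[:b:]:] * ww * ww ^ k - lin0 a c * ww * V 2 - lin0 D G * V 1"
    unfolding V0 w by (simp only: algebra_simps)
  \<comment> \<open>Setting w = 0 in the coefficient of y leaves D x^(n+1); the same in the
    coefficient of y^2 then yields \<open>B = 0\<close>.\<close>
  have "poly (coeff (lin0 D G * ?x) (Suc n)) 0 = 0" unfolding 1 by (rule coeff_ww_mult)
  hence D: "D = 0" by (simp add: lin0_def coeff_monom_mult mult.commute[of _ ?x])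
  have G: "lin0 D G = ww * [:[:G:]:]" by (simp add: D lin0_def)
  have 2: "[:[:B:]:] * ?x = ww * ([:[:b:]:] * ww ^ k - lin0 a c * V 2 - [:[:G:]:] * V 1)"
    using 2 unfolding G by (simp only: algebra_simps)
  have "poly (coeff ([:[:B:]:] * ?x) n) 0 = 0" unfolding 2 by (rule coeff_ww_mult)
  hence B: "B = 0" by simp
  have "ww * ([:[:G:]:] * ?x) = ww * (lin0 a c * ww ^ k + [:[:b:]:] * ?x - lin0 a c * V 1)"
    using 1 unfolding G by (simp only: mult.assoc)
  hence 1: "[:[:G:]:] * ?x = lin0 a c * ww ^ k + [:[:b:]:] * ?x - lin0 a c * V 1"
    by (simp only: mult_cancel_left) simp
  have "ww * ([:[:b:]:] * ww ^ k - lin0 a c * V 2 - [:[:G:]:] * V 1) = 0" using 2 B by simp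
  hence 2: "[:[:b:]:] * ww ^ k - lin0 a c * V 2 - [:[:G:]:] * V 1 = 0"
    by (simp only: mult_eq_0_iff) simp
  have "G = b"
  proof (rule ccontr)
    assume Gb: "G \<noteq> b"
    have d: "[:[:G - b:]:] * ?x = lin0 a c * (ww ^ k - V 1)"
    proof -
      have "[:[:G - b:]:] * ?x = [:[:G:]:] * ?x - [:[:b:]:] * ?x" by (simp flip: smult_diff_left)
      also have "\<dots> = lin0 a c * (ww ^ k - V 1)" unfolding 1 by (simp only: algebra_simps)
      finally show ?thesis .
    qed
    \<comment> \<open>By \<open>d\<close>, \<open>lin0 a c\<close> divides a nonzero multiple of
      x^n, so only a multiple of x is possible. In that case \<open>2\<close> and \<open>d\<close>
      combine to an identity whose coefficient of x is nonzero on the left and zero on the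
      right.\<close>
    show False
    proof (cases "c = 0")
      case True
      have a: "a \<noteq> 0" using l0 True by (simp add: lin0_eq_0_iff)
      have "[:[:b - G:]:] * (lin0 a c * ww ^ k) = lin0 a c * lin0 a c * V 2 - [:[:G:]:] * ([:[:G - b:]:] * ?x)"
      proof -
        have "(\<beta> - \<gamma>) * (L * \<omega>) = L * L * v - \<gamma> * (L * (\<omega> - v'))" if "\<beta> * \<omega> - L * v - \<gamma> * v' = 0"
          for \<beta> \<gamma> L \<omega> v v' :: "complex poly poly"
        proof -
          have "(\<beta> - \<gamma>) * (L * \<omega>) - (L * L * v - \<gamma> * (L * (\<omega> - v'))) = L * (\<beta> * \<omega> - L * v - \<gamma> * v')"
            by (simp add: algebra_simps)
          thus ?thesis using that by simp
        qed
        from this[OF 2] have "([:[:b:]:] - [:[:G:]:]) * (lin0 a c * ww ^ k)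
          = lin0 a c * lin0 a c * V 2 - [:[:G:]:] * (lin0 a c * (ww ^ k - V 1))" .
        thus ?thesis unfolding d by simp
      qed
      hence "coeff ([:[:b - G:]:] * (lin0 a c * ww ^ k)) 1 = 0"
        using k by (simp only: coeff_diff) (simp add: True lin0_def coeff_mult_1)
      thus False using a Gb True by (simp add: lin0_def const_power)
    next
      case False
      show False
      proof (cases "a = 0")
        case True
        have "[:[:G - b:]:] * ?x = ww * ([:[:c:]:] * (ww ^ k - V 1))"
          unfolding d using True by (simp add: lin0_def)
        hence "poly (coeff ([:[:G - b:]:] * ?x) n) 0 = 0" by (simp only: coeff_ww_mult)
        thus False using Gb by simp
      next
        case a: False
        have "poly ([:[:G - b:]:] * ?x) [:0, - c / a:] = 0"
          unfolding d using a by (simp add: lin0_def)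
        thus False using Gb a False by (simp add: poly_monom)
      qed
    qed
  qed
  thus ?thesis using D B by simp
qed

lemma poly_poly_0: "poly q 0 = 0 \<Longrightarrow> poly (poly F q) 0 = poly (coeff F 0) 0" for F :: "complex poly poly"
  by (cases F) simp

text \<open>If \<open>l\<close> did not divide \<open>\<rho>\<close>, its power could be cancelled
  and \<open>\<rho>\<close> would divide l P - r y^n. At y = 0 it is then l w up to a constant,
  hence identically so by \<open>conic_factor_normalised\<close>, a contradiction. For l = q y a
  factor y is cancelled first.\<close>

lemma lin_dvd_if_const_pencil:
  assumes e: "[:klein0 n, X 1 ^ n:] = [:r, l:] * G1 + [:\<rho>:] * G2" and n: "n \<ge> 3"
    and \<rho>: "\<rho> = quad a b c d e' g" and l: "l = lin p q s" and l0: "l \<noteq> 0"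
  shows "l dvd \<rho>"
proof (rule ccontr)
  assume nd: "\<not> l dvd \<rho>"
  have prime: "prime_elem l" using l0 unfolding l by (rule prime_elem_lin)
  obtain m v where "l ^ m * (l * klein0 n - r * X 1 ^ n) = \<rho> * v" using const_elimination[OF e l0] by blast
  from prime_power_cancel[OF prime nd this] obtain U where U: "\<rho> * U = l * klein0 n - r * X 1 ^ n" by (metis dvdE)
  have \<rho>0: "coeff (\<psi> \<rho>) 0 = quad0 a c e'" by (simp add: \<rho> \<psi>_0)
  show False
  proof (cases "lin0 p s = 0")
    case True
    hence ps: "p = 0" "s = 0" by (auto simp: lin0_eq_0_iff)
    have q: "q \<noteq> 0" using l0 ps by (simp add: l lin_eq_0_iff)
    have "l = C q * X 1" by (simp add: l lin_def ps ring_homD[OF ring_hom_C])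
    hence "\<not> X 1 dvd \<rho>" using nd q by (simp add: C_dvd_iff)
    hence nz: "quad0 a c e' \<noteq> 0"
      by (auto simp: \<rho> quad_def quad0_eq_0_iff ring_homD[OF ring_hom_C] power2_eq_square)
    have \<psi>l: "\<psi> l = [:0, [:[:q:]:]:]" unfolding l ps by (simp add: \<psi>_lin lin0_def)
    have n1: "monom 1 n = [:0, 1:] * (monom 1 (n - 1) :: complex poly poly poly)"
      using n by (cases n) (simp_all add: monom_Suc)
    have "\<psi> \<rho> * \<psi> U = \<psi> l * \<psi> (klein0 n) - \<psi> r * \<psi> (X 1 ^ n)"
      using arg_cong[OF U, of \<psi>] by (simp only: ring_homD[OF ring_hom_\<psi>])
    also have "\<dots> = [:0, 1:] * ([:[:[:q:]:]:] * [:ww * monom 1 n, ww ^ n:] - \<psi> r * monom 1 (n - 1))"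
      unfolding \<psi>_X1_power \<psi>l \<psi>_klein0 n1[symmetric] by (simp add: n1 algebra_simps)
    finally have e: "\<psi> \<rho> * \<psi> U = [:0, 1:] * ([:[:[:q:]:]:] * [:ww * monom 1 n, ww ^ n:] - \<psi> r * monom 1 (n - 1))" .
    have "coeff (\<psi> \<rho>) 0 * coeff (\<psi> U) 0 = 0"
      using arg_cong[OF e, of "\<lambda>p. coeff p 0"] by (simp add: coeff_mult_0)
    hence "coeff (\<psi> U) 0 = 0" using nz by (simp add: \<rho>0)
    then obtain V where V: "\<psi> U = [:0, 1:] * V" by (cases "\<psi> U") auto
    have "[:0, 1:] * (\<psi> \<rho> * V) = [:0, 1:] * ([:[:[:q:]:]:] * [:ww * monom 1 n, ww ^ n:] - \<psi> r * monom 1 (n - 1))"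
      using e unfolding V by (simp only: mult_ac)
    hence "\<psi> \<rho> * V = [:[:[:q:]:]:] * [:ww * monom 1 n, ww ^ n:] - \<psi> r * monom 1 (n - 1)"
      by (metis mult_cancel_left pCons_eq_0_iff zero_neq_one)
    thus False
      by (rule no_factor_const[where k = 2])
        (use q n in \<open>auto simp: \<rho>0 wdiv_quad0 intro: le_less_trans[OF degree_quad0]\<close>)
  next
    case False
    have e: "\<psi> \<rho> * \<psi> U = [:lin0 p s, [:[:q:]:]:] * [:ww * monom 1 n, ww ^ n:] - \<psi> r * monom 1 n"
      using arg_cong[OF U, of \<psi>] \<psi>_X1_power[of n] by (simp add: ring_homD[OF ring_hom_\<psi>] l \<psi>_lin \<psi>_klein0)
    have 0: "coeff (\<psi> \<rho>) 0 * coeff (\<psi> U) 0 = lin0 p s * ww * monom 1 n"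
      using arg_cong[OF e, of "\<lambda>p. coeff p 0"] n by (simp add: coeff_mult_0 mult_ac)
    have 1: "coeff (\<psi> \<rho>) 0 * coeff (\<psi> U) 1 + coeff (\<psi> \<rho>) 1 * coeff (\<psi> U) 0
        = lin0 p s * ww ^ n + monom 1 n * ([:[:q:]:] * ww)"
      using arg_cong[OF e, of "\<lambda>p. coeff p 1"] n
      by (simp add: coeff_mult_1 coeff_monom_mult_less mult_ac add_ac)
    obtain U' where U': "quad0 a c e' * U' = lin0 p s * ww"
      using tangent_lin0[OF 0 1 False] degree_quad0[of a c e'] n by (auto simp: \<rho>0)
    \<comment> \<open>On the line x = t w both sides are multiples of w^2. Comparing the
      coefficients of w^2, only the value \<open>u\<close> of \<open>U'\<close> at the origin
      enters.\<close>
    define u where "u = poly (coeff U' 0) 0"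
    have u: "(a * t\<^sup>2 + e' * t + c) * u = p * t + s" for t
    proof -
      have "poly (quad0 a c e' * U') [:0, t:] = poly (lin0 p s * ww) [:0, t:]" unfolding U' ..
      hence "[:0, 0, a * t\<^sup>2 + e' * t + c:] * poly U' [:0, t:] = [:0, 0, p * t + s:]"
        by (simp add: quad0_def lin0_def power2_eq_square algebra_simps smult_add_left)
      hence "smult (a * t\<^sup>2 + e' * t + c) (poly U' [:0, t:]) = [:p * t + s:]"
        by (simp add: smult_add_left algebra_simps)
      from arg_cong[OF this, of "\<lambda>p. poly p 0"] show ?thesis
        by (simp add: u_def poly_poly_0)
    qed
    have abc: "a * u = 0" "e' * u = p" "c * u = s"
      using u[of 0] u[of 1] u[of "- 1"] by (auto simp: algebra_simps)
    hence u0: "u \<noteq> 0" using False by (auto simp: lin0_eq_0_iff)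
    have "quad 0 (u * b) s (u * d) p (u * g) = C u * \<rho>"
    proof -
      have "u * a = 0" "u * e' = p" "u * c = s" using abc by (simp_all add: mult.commute)
      thus ?thesis by (simp only: \<rho> quad_mult_C)
    qed
    hence \<rho>u: "C u * \<rho> = quad 0 (u * b) s (u * d) p (u * g)" by simp
    have "(C u * \<rho>) * (C (1 / u) * U) = (C (1 / u) * C u) * (\<rho> * U)" by (simp only: mult_ac)
    hence "quad 0 (u * b) s (u * d) p (u * g) * (C (1 / u) * U) = lin p q s * klein0 n - r * X 1 ^ n"
      unfolding \<rho>u U C_mult_inverse[OF u0] l by simp
    from conic_factor_normalised[OF this False n] have "C u * \<rho> = l * X 3"
      unfolding \<rho>u l lin_mult_X3 by (simp only:)
    hence "l dvd C u * \<rho>" by simp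
    thus False using nd u0 by (simp add: dvd_C_iff)
  qed
qed

lemma lin0_mult_lin0: "lin0 a c * lin0 a' c' = quad0 (a * a') (c * c') (a * c' + a' * c)"
  by (simp add: lin0_def quad0_def algebra_simps)

lemma quad0_add: "quad0 a c e + quad0 a' c' e' = quad0 (a + a') (c + c') (e + e')"
  and quad0_smult: "[:[:u:]:] * quad0 a c e = quad0 (u * a) (u * c) (u * e)"
  by (simp_all add: quad0_def)

subsection \<open>Pencils containing a pair of planes\<close>

lemma degree_eq_0_if_mult_eq_const:
  fixes p q :: "'a::idom poly"
  assumes "p * q = [:c:]" "c \<noteq> 0"
  shows "degree p = 0"
proof -
  have "p \<noteq> 0" "q \<noteq> 0" using assms by auto
  hence "degree p + degree q = degree [:c:]" using assms(1) by (metis degree_mult_eq)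
  thus ?thesis by simp
qed

text \<open>Here y is the outer variable of the coefficients. The top coefficient in z is y^n, so
  the top coefficient of the quadric is a power of y up to a constant, and P becomes divisible by
  y^2.\<close>

lemma quadric_divides_plane_section:
  assumes e: "[:quad0 a c e', lin0 p s:] * G = [:P, monom 1 n:]" and n: "n \<ge> 3"
  shows "coeff P 0 = 0 \<and> coeff P 1 = 0"
proof (cases "lin0 p s = 0")
  case True
  have 0: "quad0 a c e' * coeff G 0 = P" using arg_cong[OF e, of "\<lambda>p. coeff p 0"] by (simp add: coeff_mult_0)
  have "quad0 a c e' * coeff G 1 = monom 1 n"
    using arg_cong[OF e, of "\<lambda>p. coeff p 1"] True by (simp add: coeff_mult_1)
  \<comment> \<open>Putting y = 1 turns the equation into a factorisation of 1, so no other variable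
    occurs in the conic.\<close>
  hence "poly (quad0 a c e') 1 * poly (coeff G 1) 1 = 1" by (metis poly_monom poly_mult power_one mult_1)
  moreover have "poly (quad0 a c e') 1 = [:a, e', c:]" by (simp add: quad0_def)
  ultimately have "[:a, e', c:] * poly (coeff G 1) 1 = [:1:]" by (simp only: one_pCons)
  hence "degree [:a, e', c:] = 0" by (rule degree_eq_0_if_mult_eq_const) simp
  hence "e' = 0" "c = 0" by (auto split: if_splits)
  thus ?thesis unfolding 0[symmetric] by (simp add: quad0_def coeff_mult_0 coeff_mult_1)
next
  case False
  have "degree G = 0"
  proof (cases "G = 0")
    case G: False
    have "degree ([:quad0 a c e', lin0 p s:] * G) = 1 + degree G" using False G by (subst degree_mult_eq) auto
    moreover have "degree [:P, monom 1 n:] \<le> 1" by simp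
    ultimately show ?thesis unfolding e by simp
  qed simp
  then obtain g where g: "G = [:g:]" by (rule degree_eq_zeroE)
  have P: "quad0 a c e' * g = P" and 1: "lin0 p s * g = monom 1 n" using e unfolding g by (simp_all add: mult.commute)
  hence "poly (lin0 p s) 1 * poly g 1 = 1" by (metis poly_monom poly_mult power_one mult_1)
  moreover have "poly (lin0 p s) 1 = [:p, s:]" by (simp add: lin0_def)
  ultimately have "[:p, s:] * poly g 1 = [:1:]" by (simp only: one_pCons)
  hence "degree [:p, s:] = 0" by (rule degree_eq_0_if_mult_eq_const) simp
  hence s: "s = 0" by (auto split: if_splits)
  hence p: "p \<noteq> 0" using False by (simp add: lin0_eq_0_iff)
  have "smult [:p:] g = monom 1 (n - 1)" using 1 s n by (cases n) (auto simp: lin0_def monom_Suc)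
  hence "coeff (smult [:p:] g) i = 0" if "i < 2" for i using that n by simp
  from this[of 0] this[of 1] have "coeff g 0 = 0" "coeff g 1 = 0" using p by auto
  thus ?thesis unfolding P[symmetric] by (simp add: coeff_mult_0 coeff_mult_1)
qed

lemma klein_eq: "klein n = X 2 * X 1 ^ n + klein0 n"
  by (simp add: klein_def klein0_def)

text \<open>Restriction to a plane through \<open>[0 : 0 : 1 : 0]\<close>, parametrised by \<open>z\<close> (outermost), \<open>y\<close> and one further variable.\<close>

definition plane_ev :: "complex poly poly \<Rightarrow> complex poly poly \<Rightarrow> mpoly \<Rightarrow> complex poly poly poly" where
  "plane_ev x w = ev (\<lambda>c. [:[:[:c:]:]:])
     (\<lambda>i. if i = 0 then [:x:] else if i = 1 then [:[:0, 1:]:] else if i = 2 then [:0, 1:] else [:w:])"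

lemma ring_hom_plane_ev: "ring_hom (plane_ev x w)"
  unfolding plane_ev_def by (intro ring_hom_ev ring_hom_const ring_hom_id)

lemma plane_ev_simps: "plane_ev x w (C c) = [:[:[:c:]:]:]" "plane_ev x w (X 0) = [:x:]"
  "plane_ev x w (X 1) = [:[:0, 1:]:]" "plane_ev x w (X (Suc 0)) = [:[:0, 1:]:]"
  "plane_ev x w (X 2) = [:0, 1:]" "plane_ev x w (X 3) = [:w:]"
  by (simp_all add: plane_ev_def ev_C ev_X ring_hom_const ring_hom_id)

lemma plane_ev_lin:
  "plane_ev (lin0 a1 b1) (lin0 a2 b2) (lin p q s) = [:lin0 (p * a1 + q + s * a2) (p * b1 + s * b2):]"
proof -
  have y: "[:0, [:q:]:] = lin0 q 0" by (simp add: lin0_def)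
  show ?thesis
    by (simp add: lin_def ring_homD[OF ring_hom_plane_ev] plane_ev_simps y)
      (simp add: lin0_def)
qed

lemma plane_ev_quad:
  "\<exists>a' c' e''. plane_ev (lin0 a1 b1) (lin0 a2 b2) (quad a b c d e g) = [:quad0 a' c' e'':]"
proof -
  have s: "plane_ev x w (quad a b c d e g) = [:[:[:a:]:] * (x * x) + [:[:b:]:] * (lin0 1 0 * lin0 1 0)
      + [:[:c:]:] * (w * w) + [:[:d:]:] * (x * lin0 1 0) + [:[:e:]:] * (w * x) + [:[:g:]:] * (lin0 1 0 * w):]" for x w
    by (simp add: quad_def ring_homD[OF ring_hom_plane_ev] plane_ev_simps power2_eq_square lin0_def one_pCons[symmetric])
  show ?thesis unfolding s lin0_mult_lin0 quad0_smult quad0_add by blast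
qed

text \<open>The assumptions \<open>v\<close> say that x = a1 y + b1 t, w = a2 y + b2 t parametrises
  the plane, on which the term with \<open>H\<close> vanishes; \<open>P\<close> is
  \<open>klein0 n\<close> on it.\<close>

lemma plane_section:
  assumes e: "klein n = (X 2 * lin p q s + quad a b c d e' g) * G + lin \<alpha> \<beta> \<gamma> * H"
    and v: "\<alpha> * a1 + \<beta> + \<gamma> * a2 = 0" "\<alpha> * b1 + \<gamma> * b2 = 0" and n: "n \<ge> 3"
  defines "P \<equiv> [:0, 1:] * lin0 a2 b2 ^ n + lin0 a2 b2 * lin0 a1 b1 ^ n"
  shows "coeff P 0 = 0 \<and> coeff P 1 = 0"
proof -
  let ?h = "plane_ev (lin0 a1 b1) (lin0 a2 b2)"
  obtain a' c' e'' where q: "?h (quad a b c d e' g) = [:quad0 a' c' e'':]" using plane_ev_quad by blast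
  have l: "?h (lin \<alpha> \<beta> \<gamma>) = 0" unfolding plane_ev_lin v by (simp add: lin0_def)
  have lam: "?h (lin p q s) = [:lin0 (p * a1 + q + s * a2) (p * b1 + s * b2):]" by (rule plane_ev_lin)
  have k: "?h (klein n) = [:P, monom 1 n:]"
    by (simp add: klein_eq klein0_def ring_homD[OF ring_hom_plane_ev] plane_ev_simps const_power P_def monom_altdef)
  have "?h (klein n) = (?h (X 2) * ?h (lin p q s) + ?h (quad a b c d e' g)) * ?h G + ?h (lin \<alpha> \<beta> \<gamma>) * ?h H"
    unfolding e by (simp add: ring_homD[OF ring_hom_plane_ev])
  hence "[:quad0 a' c' e'', lin0 (p * a1 + q + s * a2) (p * b1 + s * b2):] * ?h G = [:P, monom 1 n:]"
    unfolding k q l lam by (simp add: plane_ev_simps)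
  from quadric_divides_plane_section[OF this n] show ?thesis .
qed

lemma plane_with_conic:
  assumes e: "klein n = (X 2 * lin p q s + quad a b c d e' g) * G + lin \<alpha> \<beta> \<gamma> * H" and n: "n \<ge> 3"
  shows "\<alpha> = 0 \<and> (\<beta> = 0 \<or> \<gamma> = 0)"
proof (rule ccontr)
  assume "\<not> ?thesis"
  then consider "\<alpha> \<noteq> 0" | "\<alpha> = 0" "\<beta> \<noteq> 0" "\<gamma> \<noteq> 0" by blast
  thus False
  proof cases
    case 1
    \<comment> \<open>The plane is solved for x, with parameters y and w. The constant coefficient
      in y forces \<gamma> = 0, and then the coefficient of y is w^n.\<close>
    note P = plane_section[OF e, of "- \<beta> / \<alpha>" 0 "- \<gamma> / \<alpha>" 1]
    have w: "lin0 0 1 = ww" by (simp add: lin0_def)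
    have "\<gamma> = 0" using P 1 n by (auto simp: w coeff_mult_0 Polynomial.coeff_0_power) (simp add: lin0_def)
    have "lin0 (- \<beta> / \<alpha>) (- \<gamma> / \<alpha>) = monom [:- \<beta> / \<alpha>:] 1" by (simp add: \<open>\<gamma> = 0\<close> lin0_def monom_Suc monom_0)
    with P 1 n \<open>\<gamma> = 0\<close> show False by (auto simp: w coeff_mult_1 monom_power const_power)
  next
    case 2
    \<comment> \<open>Now w is a nonzero multiple of y and x is free, so the coefficient of y is a
      nonzero multiple of x^n.\<close>
    note P = plane_section[OF e, of 0 "- \<beta> / \<gamma>" 1 0]
    have w: "lin0 0 1 = ww" by (simp add: lin0_def)
    have x: "lin0 (- \<beta> / \<gamma>) 0 = monom [:- \<beta> / \<gamma>:] 1" by (simp add: lin0_def monom_Suc monom_0)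
    from P 2 n show False unfolding w x by (auto simp: coeff_mult_1 monom_power const_power)
  qed
qed

section \<open>Restriction to lines\<close>

definition line_ev :: "complex poly \<Rightarrow> complex poly \<Rightarrow> complex poly \<Rightarrow> complex poly \<Rightarrow> mpoly \<Rightarrow> complex poly" where
  "line_ev x y z w = ev (\<lambda>c. [:c:]) (\<lambda>i. if i = 0 then x else if i = 1 then y else if i = 2 then z else w)"

lemma ring_hom_line_ev: "ring_hom (line_ev x y z w)"
  unfolding line_ev_def by (intro ring_hom_ev ring_hom_const ring_hom_id)

lemma line_ev_simps: "line_ev x y z w (C c) = [:c:]" "line_ev x y z w (X 0) = x"
  "line_ev x y z w (X 1) = y" "line_ev x y z w (X (Suc 0)) = y"
  "line_ev x y z w (X 2) = z" "line_ev x y z w (X 3) = w"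
  by (simp_all add: line_ev_def ev_C ev_X ring_hom_const ring_hom_id)

lemmas line_ev_hom = ring_homD[OF ring_hom_line_ev] line_ev_simps power_0_left

lemma line_ev_lin: "line_ev x y z w (lin p q s) = [:p:] * x + [:q:] * y + [:s:] * w"
  by (simp add: lin_def line_ev_hom)

lemma line_ev_quad: "line_ev x y z w (quad a b c d e g) = [:a:] * x\<^sup>2 + [:b:] * y\<^sup>2 + [:c:] * w\<^sup>2
    + [:d:] * (x * y) + [:e:] * (x * w) + [:g:] * (y * w)"
  by (simp add: quad_def line_ev_hom)

text \<open>The value at parameter 0 depends only on the point there, so vanishing carries over to
  another line through that point.\<close>

lemma coeff_0_line_ev:
  assumes "coeff x 0 = coeff x' 0" "coeff y 0 = coeff y' 0" "coeff z 0 = coeff z' 0" "coeff w 0 = coeff w' 0"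
  shows "coeff (line_ev x y z w p) 0 = coeff (line_ev x' y' z' w' p) 0"
proof -
  have h: "ring_hom (\<lambda>p. coeff p 0 :: complex)" by (simp add: ring_hom_def coeff_mult_0)
  have "(\<lambda>p. coeff p 0) \<circ> (\<lambda>i. if i = 0 then x else if i = 1 then y else if i = 2 then z else w)
      = (\<lambda>p. coeff p 0) \<circ> (\<lambda>i. if i = 0 then x' else if i = (1::nat) then y' else if i = 2 then z' else w')"
    using assms by auto
  thus ?thesis unfolding line_ev_def ring_hom_comp_ev[OF h] by simp
qed

lemma monom_factor:
  fixes p q :: "complex poly"
  assumes "p * q = monom c n" "c \<noteq> 0"
  shows "coeff p 0 \<noteq> 0 \<Longrightarrow> degree p = 0" "degree p < n \<Longrightarrow> coeff q 0 = 0"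
proof -
  have m: "monom 1 (n + 0) dvd p * q" unfolding assms(1)
    by (rule dvdI[of _ _ "[:c:]"]) (simp add: smult_monom)
  have nd: "coeff r 0 \<noteq> 0 \<Longrightarrow> \<not> monom 1 (Suc 0) dvd r" for r :: "complex poly" by (simp add: monom_1_dvd_iff')
  {
    assume "coeff p 0 \<noteq> 0"
    from monom_dvd_mult_cancel[OF m nd[OF this]] obtain h where h: "q = monom 1 n * h" by auto
    have "monom 1 n * (p * h) = monom 1 n * [:c:]" using assms(1) unfolding h by (simp add: mult_ac smult_monom)
    hence "p * h = [:c:]" by (metis mult_cancel_left monom_eq_0_iff zero_neq_one)
    thus "degree p = 0" using assms(2) by (rule degree_eq_0_if_mult_eq_const)
  next
    assume d: "degree p < n"
    show "coeff q 0 = 0"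
    proof (rule ccontr)
      assume "coeff q 0 \<noteq> 0"
      from monom_dvd_mult_cancel[OF _ nd[OF this], of n p] m have "monom 1 n dvd p" by (simp add: mult.commute)
      moreover have "p \<noteq> 0" using assms by auto
      ultimately have "degree (monom (1::complex) n) \<le> degree p" by (intro dvd_imp_degree_le)
      thus False using d by (simp add: degree_monom_eq)
    qed
  }
qed

lemma vanishing_order_two:
  assumes "[:0, 1:] = a * b + c * c' * (h :: complex poly)"
    "coeff a 0 = 0" "coeff b 0 = 0" "coeff c 0 = 0" "coeff c' 0 = 0"
  shows False
  using arg_cong[OF assms(1), of "\<lambda>p. coeff p 1"] assms(2-) by (simp add: coeff_mult_1 coeff_mult_0)

text \<open>At a point [1 : 0 : z : 0] with z nonzero where Q vanishes, G vanishes too, since Q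
  restricted to w = 0 cannot absorb the n-fold zero of z y^n. The right side then has order 2 at
  that point, but f has the linear term w.\<close>

lemma not_two_planes_X3:
  assumes e: "klein n = (X 2 * lin p q s + quad a b c d e' g) * G + X 3 * l * H"
    and l: "l = X 1 \<or> l = X 3" and n: "n \<ge> 3"
  shows False
proof -
  let ?Q = "X 2 * lin p q s + quad a b c d e' g"
  let ?y = "[:0, 1:] :: complex poly"
  have fac: "line_ev 1 ?y [:z:] 0 ?Q * line_ev 1 ?y [:z:] 0 G = monom z n" for z
    using arg_cong[OF e, of "line_ev 1 ?y [:z:] 0"] n by (simp add: klein_def line_ev_hom monom_altdef)
  have Q: "line_ev 1 ?y [:z:] 0 ?Q = [:z * p + a, z * q + d, b:]" for z
    by (simp only: line_ev_hom line_ev_lin line_ev_quad) (simp add: power2_eq_square one_pCons)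
  \<comment> \<open>If Q had no such zero, it would be constant on each of these lines. Two values
    of z then make it vanish on x = w = 0, where f does not.\<close>
  have "\<exists>z. z \<noteq> 0 \<and> z * p + a = 0"
  proof (rule ccontr)
    assume no: "\<nexists>z. z \<noteq> 0 \<and> z * p + a = 0"
    have "degree [:z * p + a, z * q + d, b:] = 0" if "z \<noteq> 0" for z
    proof -
      have "coeff [:z * p + a, z * q + d, b:] 0 \<noteq> 0" using no that by auto
      thus ?thesis using monom_factor(1)[OF fac that] unfolding Q by blast
    qed
    from this[of 1] this[of 2] have z: "b = 0" "q + d = 0" "2 * q + d = 0" by (auto split: if_splits)
    have "q = (2 * q + d) - (q + d)" by simp
    hence "q = 0" using z by simp
    have "line_ev 0 ?y 1 0 ?Q * line_ev 0 ?y 1 0 G = monom 1 n"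
      using arg_cong[OF e, of "line_ev 0 ?y 1 0"] n by (simp add: klein_def line_ev_hom monom_altdef)
    moreover have "line_ev 0 ?y 1 0 ?Q = 0"
      using \<open>q = 0\<close> \<open>b = 0\<close> by (simp add: line_ev_hom line_ev_lin line_ev_quad)
    ultimately show False by simp
  qed
  then obtain z where z: "z \<noteq> 0" "z * p + a = 0" by blast
  have "degree [:z * p + a, z * q + d, b:] < n" using n by (auto intro: le_less_trans[of _ 2])
  hence "coeff (line_ev 1 ?y [:z:] 0 G) 0 = 0" using monom_factor(2)[OF fac z(1)] unfolding Q by blast
  hence G0: "coeff (line_ev 1 0 [:z:] ?y G) 0 = 0"
    using coeff_0_line_ev[of 1 1 ?y 0 "[:z:]" "[:z:]" 0 ?y G] by simp
  have eq: "[:0, 1:] = line_ev 1 0 [:z:] ?y ?Q * line_ev 1 0 [:z:] ?y G + [:0, 1:] * line_ev 1 0 [:z:] ?y l * line_ev 1 0 [:z:] ?y H"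
    using arg_cong[OF e, of "line_ev 1 0 [:z:] ?y"] n by (simp add: klein_def line_ev_hom)
  have Q0: "coeff (line_ev 1 0 [:z:] ?y ?Q) 0 = 0" and l0: "coeff (line_ev 1 0 [:z:] ?y l) 0 = 0"
    using z l by (auto simp: line_ev_hom line_ev_lin line_ev_quad coeff_mult_0 power2_eq_square mult.commute)
  show False by (rule vanishing_order_two[OF eq Q0 G0 _ l0]) simp
qed

text \<open>The same argument at the point [0 : 0 : 0 : 1], where the linear term of f is y. If Q
  did not vanish there, it would restrict to c w^2 on y = z = 0, where f is w x^n.\<close>

lemma not_two_planes_X1:
  assumes e: "klein n = (X 2 * lin p q s + quad a b c d e' g) * G + X 1 * X 1 * H" and n: "n \<ge> 3"
  shows False
proof -
  let ?Q = "X 2 * lin p q s + quad a b c d e' g"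
  let ?x = "[:0, 1:] :: complex poly"
  have fac: "line_ev ?x 0 0 1 ?Q * line_ev ?x 0 0 1 G = monom 1 n"
    using arg_cong[OF e, of "line_ev ?x 0 0 1"] n by (simp add: klein_def line_ev_hom monom_altdef)
  have Q: "line_ev ?x 0 0 1 ?Q = [:c, e', a:]"
    by (simp only: line_ev_hom line_ev_lin line_ev_quad) (simp add: power2_eq_square one_pCons)
  have "c = 0"
  proof (rule ccontr)
    assume c: "c \<noteq> 0"
    hence "degree [:c, e', a:] = 0" using monom_factor(1)[OF fac, unfolded Q] by simp
    hence "a = 0" "e' = 0" by (auto split: if_splits)
    hence "line_ev 1 0 0 ?x ?Q = [:0, 0, c:]" by (simp only: line_ev_hom line_ev_lin line_ev_quad) (simp add: power2_eq_square one_pCons)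
    moreover have "line_ev 1 0 0 ?x ?Q * line_ev 1 0 0 ?x G = [:0, 1:]"
      using arg_cong[OF e, of "line_ev 1 0 0 ?x"] n by (simp add: klein_def line_ev_hom)
    ultimately have "coeff ([:0, 0, c:] * line_ev 1 0 0 ?x G) 1 = 1" by simp
    thus False by (simp add: coeff_mult_1)
  qed
  have "degree [:c, e', a:] < n" using n by (auto intro: le_less_trans[of _ 2])
  hence "coeff (line_ev ?x 0 0 1 G) 0 = 0" using monom_factor(2)[OF fac] unfolding Q by simp
  hence G0: "coeff (line_ev 0 ?x 0 1 G) 0 = 0"
    using coeff_0_line_ev[of ?x 0 0 ?x 0 0 1 1 G] by simp
  have eq: "[:0, 1:] = line_ev 0 ?x 0 1 ?Q * line_ev 0 ?x 0 1 G + ?x * ?x * line_ev 0 ?x 0 1 H"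
    using arg_cong[OF e, of "line_ev 0 ?x 0 1"] n by (simp add: klein_def line_ev_hom)
  have Q0: "coeff (line_ev 0 ?x 0 1 ?Q) 0 = 0"
    using \<open>c = 0\<close> by (auto simp: line_ev_hom line_ev_lin line_ev_quad coeff_mult_0 power2_eq_square mult.commute)
  show False by (rule vanishing_order_two[OF eq Q0 G0]) simp_all
qed

text \<open>By \<open>plane_with_conic\<close> both linear forms are multiples of y or w, so their
  product is a multiple of y^2, of y w or of w^2.\<close>

lemma not_reducible_pencil:
  assumes e: "klein n = (X 2 * lin p q s + quad a b c d e' g) * G + lin \<alpha> \<beta> \<gamma> * lin \<alpha>' \<beta>' \<gamma>' * H" and n: "n \<ge> 3"
  shows False
proof -
  let ?l = "lin \<alpha> \<beta> \<gamma>" and ?l' = "lin \<alpha>' \<beta>' \<gamma>'"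
  have s: "\<alpha> = 0 \<and> (\<beta> = 0 \<or> \<gamma> = 0)" "\<alpha>' = 0 \<and> (\<beta>' = 0 \<or> \<gamma>' = 0)"
    using plane_with_conic[of n p q s a b c d e' g G \<alpha> \<beta> \<gamma> "?l' * H"]
      plane_with_conic[of n p q s a b c d e' g G \<alpha>' \<beta>' \<gamma>' "?l * H"] e n
    by (simp_all add: mult_ac)
  have "?l = C \<beta> * X 1 \<or> ?l = C \<gamma> * X 3" "?l' = C \<beta>' * X 1 \<or> ?l' = C \<gamma>' * X 3"
    using s by (auto simp: lin_def ring_homD[OF ring_hom_C])
  hence "(\<exists>H'. ?l * ?l' * H = X 1 * X 1 * H') \<or> (\<exists>l H'. (l = X 1 \<or> l = X 3) \<and> ?l * ?l' * H = X 3 * l * H')"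
  proof (elim disjE)
    assume 1: "?l = C \<beta> * X 1" "?l' = C \<beta>' * X 1"
    have "?l * ?l' * H = X 1 * X 1 * (C \<beta> * C \<beta>' * H)" unfolding 1 by (simp add: mult_ac)
    thus ?thesis by blast
  next
    assume 1: "?l = C \<beta> * X 1" "?l' = C \<gamma>' * X 3"
    have "?l * ?l' * H = X 3 * X 1 * (C \<beta> * C \<gamma>' * H)" unfolding 1 by (simp add: mult_ac)
    thus ?thesis by blast
  next
    assume 1: "?l = C \<gamma> * X 3" "?l' = C \<beta>' * X 1"
    have "?l * ?l' * H = X 3 * X 1 * (C \<gamma> * C \<beta>' * H)" unfolding 1 by (simp add: mult_ac)
    thus ?thesis by blast
  next
    assume 1: "?l = C \<gamma> * X 3" "?l' = C \<gamma>' * X 3"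
    have "?l * ?l' * H = X 3 * X 3 * (C \<gamma> * C \<gamma>' * H)" unfolding 1 by (simp add: mult_ac)
    thus ?thesis by blast
  qed
  thus False
  proof (rule disjE; elim exE conjE)
    fix H' assume "?l * ?l' * H = X 1 * X 1 * H'"
    hence "klein n = (X 2 * lin p q s + quad a b c d e' g) * G + X 1 * X 1 * H'" using e by simp
    from not_two_planes_X1[OF this n] show False .
  next
    fix l H' assume l: "l = X 1 \<or> l = X 3" and "?l * ?l' * H = X 3 * l * H'"
    hence "klein n = (X 2 * lin p q s + quad a b c d e' g) * G + X 3 * l * H'" using e by simp
    from not_two_planes_X3[OF this l n] show False .
  qed
qed

section \<open>Degenerate conics\<close>

lemma square_of_binary_form:
  assumes "b\<^sup>2 = 4 * a * (c :: complex)"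
  shows "\<exists>u v. u\<^sup>2 = a \<and> v\<^sup>2 = c \<and> 2 * u * v = b"
proof (cases "a = 0")
  case True
  thus ?thesis using assms by (intro exI[of _ 0] exI[of _ "csqrt c"]) auto
next
  case False
  define u where "u = csqrt a"
  have u: "u\<^sup>2 = a" "u \<noteq> 0" using False by (auto simp: u_def)
  have "(b / (2 * u))\<^sup>2 = c" using assms u False by (simp add: power_divide power_mult_distrib)
  thus ?thesis using u by (intro exI[of _ u] exI[of _ "b / (2 * u)"]) simp
qed

text \<open>Four times the determinant of the symmetric matrix of
  \<open>quad a b c d e g\<close>.\<close>

definition conic_disc :: "complex \<Rightarrow> complex \<Rightarrow> complex \<Rightarrow> complex \<Rightarrow> complex \<Rightarrow> complex \<Rightarrow> complex" where
  "conic_disc a b c d e g = 4 * a * b * c + d * e * g - a * g\<^sup>2 - b * e\<^sup>2 - c * d\<^sup>2"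

text \<open>As a quadratic polynomial in x the conic has as discriminant a binary form in y and w.
  The discriminant of that form is a multiple of \<open>conic_disc\<close>, so it is a square (u y +
  v w)^2 and the quadratic formula splits the conic.\<close>

lemma degenerate_conic_aux:
  assumes disc: "conic_disc a b c d e g = 0" and a: "a \<noteq> 0"
  shows "\<exists>p q s p' q' s'. p * p' = a \<and> q * q' = b \<and> s * s' = c \<and> p * q' + p' * q = d
    \<and> p * s' + p' * s = e \<and> q * s' + q' * s = g"
proof -
  have "(4 * a * g - 2 * d * e)\<^sup>2 - 4 * (d\<^sup>2 - 4 * a * b) * (e\<^sup>2 - 4 * a * c) = - 16 * a * conic_disc a b c d e g"
    by (simp add: conic_disc_def algebra_simps power2_eq_square)
  hence "(2 * d * e - 4 * a * g)\<^sup>2 = 4 * (d\<^sup>2 - 4 * a * b) * (e\<^sup>2 - 4 * a * c)"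
    using disc by (simp add: power2_commute)
  from square_of_binary_form[OF this] obtain u v where
    u: "u\<^sup>2 = d\<^sup>2 - 4 * a * b" "v\<^sup>2 = e\<^sup>2 - 4 * a * c" "2 * u * v = 2 * d * e - 4 * a * g" by blast
  have "(d - u) * (d + u) = 4 * a * b" "(e - v) * (e + v) = 4 * a * c" "(d - u) * (e + v) + (d + u) * (e - v) = 4 * a * g"
    using u by (simp_all add: algebra_simps power2_eq_square)
  hence 1: "(d - u) * (d + u) / (4 * a) = b" "(e - v) * (e + v) / (4 * a) = c"
    "((d - u) * (e + v) + (d + u) * (e - v)) / (4 * a) = g" using a by simp_all
  have t: "x / (2 * a) * (y / 2) = x * y / (4 * a)" "x / 2 * (y / (2 * a)) = x * y / (4 * a)" for x y :: complex
    by simp_all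
  have qs: "(d - u) / (2 * a) * ((d + u) / 2) = b" "(e - v) / (2 * a) * ((e + v) / 2) = c"
    unfolding 1(1,2)[symmetric] t by (rule refl)+
  have g: "(d - u) / (2 * a) * ((e + v) / 2) + (d + u) / 2 * ((e - v) / (2 * a)) = g"
    unfolding 1(3)[symmetric] t by (rule add_divide_distrib[symmetric])
  have p: "1 * ((x + y) / 2) + a * ((x - y) / (2 * a)) = x" for x y :: complex
  proof -
    have "a * ((x - y) / (2 * a)) = (x - y) / 2" using a by simp
    moreover have "(x + y) / 2 + (x - y) / 2 = x" unfolding add_divide_distrib[symmetric] by simp
    ultimately show ?thesis by (simp only: mult_1_left)
  qed
  show ?thesis
    by (intro exI[of _ 1] exI[of _ "(d - u) / (2 * a)"] exI[of _ "(e - v) / (2 * a)"]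
        exI[of _ a] exI[of _ "(d + u) / 2"] exI[of _ "(e + v) / 2"] conjI) (rule mult_1_left qs g p)+
qed

text \<open>A permutation of the variables brings a nonzero square coefficient to the front. If all
  three vanish, so does d e g, and one variable can be factored out.\<close>

lemma degenerate_conic:
  assumes "conic_disc a b c d e g = 0"
  shows "\<exists>p q s p' q' s'. quad a b c d e g = lin p q s * lin p' q' s'"
proof -
  have lin: "lin p q s * lin p' q' s' = quad (p * p') (q * q') (s * s') (p * q' + p' * q) (p * s' + p' * s) (q * s' + q' * s)"
    for p q s p' q' s'
    by (simp add: lin_def quad_def ring_homD[OF ring_hom_C] power2_eq_square algebra_simps)
  consider "a \<noteq> 0" | "b \<noteq> 0" | "c \<noteq> 0" | "a = 0" "b = 0" "c = 0" by blast
  hence "\<exists>p q s p' q' s'. p * p' = a \<and> q * q' = b \<and> s * s' = c \<and> p * q' + p' * q = d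
    \<and> p * s' + p' * s = e \<and> q * s' + q' * s = g"
  proof cases
    case 1
    thus ?thesis using degenerate_conic_aux assms by blast
  next
    case 2
    have "conic_disc b a c d g e = 0" using assms by (simp add: conic_disc_def algebra_simps)
    from degenerate_conic_aux[OF this 2] obtain p q s p' q' s' where
      "p * p' = b" "q * q' = a" "s * s' = c" "p * q' + p' * q = d" "p * s' + p' * s = g" "q * s' + q' * s = e" by blast
    thus ?thesis by - (rule exI[of _ q], rule exI[of _ p], rule exI[of _ s], rule exI[of _ q'], rule exI[of _ p'], rule exI[of _ s'], simp add: mult.commute add.commute)
  next
    case 3
    have "conic_disc c b a g e d = 0" using assms by (simp add: conic_disc_def algebra_simps)
    from degenerate_conic_aux[OF this 3] obtain p q s p' q' s' where
      "p * p' = c" "q * q' = b" "s * s' = a" "p * q' + p' * q = g" "p * s' + p' * s = e" "q * s' + q' * s = d" by blast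
    thus ?thesis by - (rule exI[of _ s], rule exI[of _ q], rule exI[of _ p], rule exI[of _ s'], rule exI[of _ q'], rule exI[of _ p'], simp add: mult.commute add.commute)
  next
    case 4
    hence "d = 0 \<or> e = 0 \<or> g = 0" using assms by (simp add: conic_disc_def)
    thus ?thesis
    proof (elim disjE)
      assume "d = 0"
      with 4 show ?thesis
        by - (rule exI[of _ 0], rule exI[of _ 0], rule exI[of _ 1], rule exI[of _ e], rule exI[of _ g], rule exI[of _ 0], simp)
    next
      assume "e = 0"
      with 4 show ?thesis
        by - (rule exI[of _ 0], rule exI[of _ 1], rule exI[of _ 0], rule exI[of _ d], rule exI[of _ 0], rule exI[of _ g], simp)
    next
      assume "g = 0"
      with 4 show ?thesis
        by - (rule exI[of _ 1], rule exI[of _ 0], rule exI[of _ 0], rule exI[of _ 0], rule exI[of _ d], rule exI[of _ e], simp)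
    qed
  qed
  then obtain p q s p' q' s' where "p * p' = a" "q * q' = b" "s * s' = c" "p * q' + p' * q = d"
    "p * s' + p' * s = e" "q * s' + q' * s = g" by blast
  hence "quad a b c d e g = lin p q s * lin p' q' s'" unfolding lin by simp
  thus ?thesis by blast
qed

text \<open>Along u Q + Q' the discriminant is a polynomial in u with coefficient
  \<open>conic_disc a b c d e g\<close> at u^3; if that is nonzero, there is a root.\<close>

lemma pencil_has_degenerate_conic:
  "\<exists>u v. (u \<noteq> 0 \<or> v \<noteq> 0) \<and> conic_disc (u * a + v * a') (u * b + v * b') (u * c + v * c')
     (u * d + v * d') (u * e + v * e') (u * g + v * g') = 0"
proof (cases "conic_disc a b c d e g = 0")
  case True
  thus ?thesis by (intro exI[of _ 1] exI[of _ 0]) simp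
next
  case False
  define p where "p = [:4:] * [:a', a:] * [:b', b:] * [:c', c:] + [:d', d:] * [:e', e:] * [:g', g:]
    - [:a', a:] * [:g', g:]\<^sup>2 - [:b', b:] * [:e', e:]\<^sup>2 - [:c', c:] * [:d', d:]\<^sup>2"
  have p: "poly p u = conic_disc (u * a + a') (u * b + b') (u * c + c') (u * d + d') (u * e + e') (u * g + g')" for u
    by (simp add: p_def conic_disc_def power2_eq_square algebra_simps)
  have "coeff p 3 = conic_disc a b c d e g"
    by (simp add: p_def conic_disc_def numeral_3_eq_3 power2_eq_square algebra_simps)
  hence "degree p \<noteq> 0" using False coeff_eq_0[of p 3] by force
  hence "\<not> constant (poly p)" by (simp add: constant_degree)
  from fundamental_theorem_of_algebra[OF this] obtain u where "poly p u = 0" by blast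
  thus ?thesis unfolding p by (intro exI[of _ u] exI[of _ 1]) simp
qed

lemma not_concurrent_pencil:
  assumes e: "klein n = quad a b c d e' g * G + quad a' b' c' d' e'' g' * H" and n: "n \<ge> 3"
  shows False
proof -
  have red: False if e: "klein n = quad a b c d e' g * G + quad a' b' c' d' e'' g' * H"
    and u: "u \<noteq> 0" and disc: "conic_disc (u * a + v * a') (u * b + v * b') (u * c + v * c')
      (u * d + v * d') (u * e' + v * e'') (u * g + v * g') = 0"
    for u v a b c d e' g a' b' c' d' e'' g' G H
  proof -
    from degenerate_conic[OF disc] obtain p q s p' q' s' where
      l: "C u * quad a b c d e' g + C v * quad a' b' c' d' e'' g' = lin p q s * lin p' q' s'"
      unfolding quad_mult_C by (auto simp: quad_def ring_homD[OF ring_hom_C] algebra_simps)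
    let ?i = "C (1 / u)"
    \<comment> \<open>As \<open>u\<close> is nonzero, the degenerate member can replace the first
      conic in the pencil.\<close>
    have "klein n = quad a' b' c' d' e'' g' * (H - ?i * C v * G)
      + (C u * quad a b c d e' g + C v * quad a' b' c' d' e'' g') * (?i * G) + (1 - ?i * C u) * (quad a b c d e' g * G)"
      unfolding e by (simp add: algebra_simps)
    hence "klein n = (X 2 * lin 0 0 0 + quad a' b' c' d' e'' g') * (H - ?i * C v * G) + lin p q s * lin p' q' s' * (?i * G)"
      unfolding l C_mult_inverse[OF u] by (simp add: lin_def ring_homD[OF ring_hom_C])
    thus False using n by (rule not_reducible_pencil)
  qed
  obtain u v where uv: "u \<noteq> 0 \<or> v \<noteq> 0" and disc: "conic_disc (u * a + v * a') (u * b + v * b') (u * c + v * c')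
      (u * d + v * d') (u * e' + v * e'') (u * g + v * g') = 0"
    using pencil_has_degenerate_conic by blast
  show False
  proof (cases "u = 0")
    case False
    thus False using red[OF e _ disc] by blast
  next
    case True
    have "klein n = quad a' b' c' d' e'' g' * H + quad a b c d e' g * G" using e by (simp add: add.commute)
    thus False using red[of a' b' c' d' e'' g' H a b c d e' g G v u] uv True disc by (simp add: add.commute)
  qed
qed

text \<open>The coefficients stay in \<open>mpoly\<close>, so that the prime linear forms remain
  available after z has been singled out.\<close>

definition over_z :: "mpoly \<Rightarrow> mpoly poly" where
  "over_z = ev (\<lambda>c. [:C c:]) (\<lambda>i. if i = 2 then [:0, 1:] else [:X i:])"

lemma ring_hom_over_z: "ring_hom over_z"
  unfolding over_z_def by (intro ring_hom_ev ring_hom_const ring_hom_C)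

lemma over_z_simps: "over_z (C c) = [:C c:]" "over_z (X i) = (if i = 2 then [:0, 1:] else [:X i:])"
  by (simp_all add: over_z_def ev_C ev_X ring_hom_const ring_hom_C)

lemma over_z_klein: "over_z (klein n) = [:klein0 n, X 1 ^ n:]"
  by (simp add: klein_def klein0_def ring_homD[OF ring_hom_over_z] over_z_simps const_power)

lemma over_z_lin: "over_z (lin a b c) = [:lin a b c:]"
  by (simp add: lin_def ring_homD[OF ring_hom_over_z] over_z_simps)

lemma over_z_quad: "over_z (quad a b c d e g) = [:quad a b c d e g:]"
  by (simp add: quad_def ring_homD[OF ring_hom_over_z] over_z_simps const_power)

definition quadric :: "complex \<Rightarrow> mpoly \<Rightarrow> mpoly \<Rightarrow> mpoly" where
  "quadric k l r = C k * X 2 ^ 2 + X 2 * l + r"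

lemma over_z_quadric:
  "over_z (quadric k (lin p q s) (quad a b c d e g)) = [:quad a b c d e g, lin p q s, C k:]"
  by (simp add: quadric_def ring_homD[OF ring_hom_over_z] over_z_simps over_z_lin over_z_quad power2_eq_square)

subsection \<open>All pencils of quadrics\<close>

lemma C_0: "C 0 = 0" and C_1: "C 1 = 1"
  using ring_homD(1,4)[OF ring_hom_C] by auto

lemma X1_dvd_quad:
  assumes "X 1 dvd quad a b c d e g"
  shows "quad a b c d e g = lin 0 1 0 * lin d b g"
proof -
  obtain k where "quad a b c d e g = X 1 * k" using assms by auto
  hence k: "ev (\<lambda>x. x) t (quad a b c d e g) = ev (\<lambda>x. x) t (X 1) * ev (\<lambda>x. x) t k" for t :: "nat \<Rightarrow> complex"
    by (simp add: cev_simps)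
  have t: "a * (t 0)\<^sup>2 + c * (t 3)\<^sup>2 + e * (t 0 * t 3) = 0" if "t 1 = 0" for t :: "nat \<Rightarrow> complex"
    using k[of t] that by (simp add: quad_def cev_simps)
  have "a = 0" using t[of "\<lambda>i. if i = 0 then 1 else 0"] by simp
  moreover have "c = 0" using t[of "\<lambda>i. if i = 3 then 1 else 0"] by simp
  ultimately have "e = 0" using t[of "\<lambda>i. if i = 0 \<or> i = 3 then 1 else 0"] by simp
  show ?thesis unfolding \<open>a = 0\<close> \<open>c = 0\<close> \<open>e = 0\<close>
    by (simp add: quad_def lin_def C_0 C_1 algebra_simps power2_eq_square)
qed

lemma X3_dvd_quad:
  assumes "X 3 dvd quad a b c d e g"
  shows "quad a b c d e g = lin 0 0 1 * lin e g c"
proof -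
  obtain k where "quad a b c d e g = X 3 * k" using assms by auto
  hence k: "ev (\<lambda>x. x) t (quad a b c d e g) = ev (\<lambda>x. x) t (X 3) * ev (\<lambda>x. x) t k" for t :: "nat \<Rightarrow> complex"
    by (simp add: cev_simps)
  have t: "a * (t 0)\<^sup>2 + b * (t 1)\<^sup>2 + d * (t 0 * t 1) = 0" if "t 3 = 0" for t :: "nat \<Rightarrow> complex"
    using k[of t] that by (simp add: quad_def cev_simps)
  have "a = 0" using t[of "\<lambda>i. if i = 0 then 1 else 0"] by simp
  moreover have "b = 0" using t[of "\<lambda>i. if i = 1 then 1 else 0"] by simp
  ultimately have "d = 0" using t[of "\<lambda>i. if i = 0 \<or> i = 1 then 1 else 0"] by simp
  show ?thesis unfolding \<open>a = 0\<close> \<open>b = 0\<close> \<open>d = 0\<close>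
    by (simp add: quad_def lin_def C_0 C_1 algebra_simps power2_eq_square)
qed

text \<open>If l is nonzero, it divides the second quadric, so the plane l = 0 meets the hypothesis
  of \<open>plane_with_conic\<close> and is y = 0 or w = 0. The second quadric is then a pair of
  planes.\<close>

lemma not_cone_pencil:
  assumes e: "klein n = quadric 0 (lin p q s) (quad a b c d e' g) * G + quadric 0 (lin 0 0 0) (quad a' b' c' d' e'' g') * H"
    and n: "n \<ge> 3"
  shows False
proof -
  let ?\<rho> = "quad a' b' c' d' e'' g'"
  have e': "klein n = (X 2 * lin p q s + quad a b c d e' g) * G + ?\<rho> * H"
    using e by (simp add: quadric_def lin_def C_0)
  show False
  proof (cases "lin p q s = 0")
    case True
    hence "klein n = quad a b c d e' g * G + ?\<rho> * H" using e' by simp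
    thus False using n by (rule not_concurrent_pencil)
  next
    case False
    have "[:klein0 n, X 1 ^ n:] = [:quad a b c d e' g, lin p q s:] * over_z G + [:?\<rho>:] * over_z H"
      using arg_cong[OF e, of over_z] unfolding ring_homD[OF ring_hom_over_z] over_z_klein over_z_quadric
      by (simp add: C_0 lin_def)
    from lin_dvd_if_const_pencil[OF this n refl refl False] obtain k where k: "?\<rho> = lin p q s * k" by auto
    have "klein n = (X 2 * lin p q s + quad a b c d e' g) * G + lin p q s * (k * H)"
      using e' unfolding k by (simp add: mult_ac)
    from plane_with_conic[OF this n] have "lin p q s = C q * X 1 \<or> lin p q s = C s * X 3"
      by (auto simp: lin_def C_0)
    hence "X 1 dvd ?\<rho> \<or> X 3 dvd ?\<rho>" unfolding k by auto
    thus False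
    proof
      assume "X 1 dvd ?\<rho>"
      from e'[unfolded X1_dvd_quad[OF this]] n show False by (rule not_reducible_pencil)
    next
      assume "X 3 dvd ?\<rho>"
      from e'[unfolded X3_dvd_quad[OF this]] n show False by (rule not_reducible_pencil)
    qed
  qed
qed

definition is_quadric :: "complex \<Rightarrow> mpoly \<Rightarrow> bool" where
  "is_quadric k Q \<longleftrightarrow> (\<exists>p q s a b c d e g. Q = quadric k (lin p q s) (quad a b c d e g))"

lemma C_mult_lin: "C u * lin p q s = lin (u * p) (u * q) (u * s)"
  by (simp add: lin_def ring_homD[OF ring_hom_C] algebra_simps)

lemma lin_add: "lin p q s + lin p' q' s' = lin (p + p') (q + q') (s + s')"
  by (simp add: lin_def ring_homD[OF ring_hom_C] algebra_simps)

lemma quad_add: "quad a b c d e g + quad a' b' c' d' e' g' = quad (a + a') (b + b') (c + c') (d + d') (e + e') (g + g')"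
  by (simp add: quad_def ring_homD[OF ring_hom_C] algebra_simps)

lemma quadric_add: "quadric k l r + quadric k' l' r' = quadric (k + k') (l + l') (r + r')"
  and C_mult_quadric: "C u * quadric k l r = quadric (u * k) (C u * l) (C u * r)"
  by (simp_all add: quadric_def ring_homD[OF ring_hom_C] algebra_simps)

lemma is_quadric_add: "is_quadric k Q \<Longrightarrow> is_quadric k' Q' \<Longrightarrow> is_quadric (k + k') (Q + Q')"
  unfolding is_quadric_def by (elim exE) (simp only: quadric_add lin_add quad_add, blast)

lemma is_quadric_C_mult: "is_quadric k Q \<Longrightarrow> is_quadric (u * k) (C u * Q)"
  unfolding is_quadric_def by (elim exE) (simp only: C_mult_quadric C_mult_lin quad_mult_C, blast)

lemma not_quadric_pencil_monic:
  assumes e: "klein n = Q1 * G1 + Q2 * G2" and Q: "is_quadric k1 Q1" "is_quadric k2 Q2"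
    and k2: "k2 \<noteq> 0" and n: "n \<ge> 5"
  shows False
proof -
  let ?Q2 = "C (1 / k2) * Q2"
  \<comment> \<open>Subtracting \<open>k1\<close> times the normalised member removes z^2 from the
    first quadric; the second cofactor absorbs the change.\<close>
  let ?Q1 = "Q1 + C (- k1) * ?Q2"
  have 2: "is_quadric 1 ?Q2" using is_quadric_C_mult[OF Q(2), of "1 / k2"] k2 by simp
  have 1: "is_quadric 0 ?Q1" using is_quadric_add[OF Q(1) is_quadric_C_mult[OF 2, of "- k1"]] by simp
  have "?Q1 * G1 + ?Q2 * (C k2 * G2 + C k1 * G1) = Q1 * G1 + (C (1 / k2) * C k2) * (Q2 * G2)"
    by (simp add: ring_homD[OF ring_hom_C] algebra_simps)
  hence e: "klein n = ?Q1 * G1 + ?Q2 * (C k2 * G2 + C k1 * G1)"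
    unfolding e C_mult_inverse[OF k2] by simp
  obtain p q s a b c d e' g where 1: "?Q1 = quadric 0 (lin p q s) (quad a b c d e' g)"
    using 1 unfolding is_quadric_def by blast
  obtain p' q' s' a' b' c' d' e'' g' where 2: "?Q2 = quadric 1 (lin p' q' s') (quad a' b' c' d' e'' g')"
    using 2 unfolding is_quadric_def by blast
  have e': "klein n = quadric 0 (lin p q s) (quad a b c d e' g) * G1
      + quadric 1 (lin p' q' s') (quad a' b' c' d' e'' g') * (C k2 * G2 + C k1 * G1)"
    unfolding 1[symmetric] 2[symmetric] by (rule e)
  have "[:klein0 n, X 1 ^ n:] = [:quad a b c d e' g, lin p q s:] * over_z G1
      + [:quad a' b' c' d' e'' g', lin p' q' s', 1:] * over_z (C k2 * G2 + C k1 * G1)"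
    using arg_cong[OF e', of over_z] unfolding ring_homD(2,3)[OF ring_hom_over_z] over_z_klein over_z_quadric
    by (simp add: C_0 C_1)
  from not_monic_elimination[OF this n refl refl refl refl] show False .
qed

text \<open>Without z^2 the coefficients l and l' of z decide. If l divides l', some member of the
  pencil is free of z. Otherwise \<open>not_linear_pencil\<close> wants a first coefficient that is
  not a multiple of y; if l is a nonzero multiple, then l' is not, and the quadrics are
  exchanged.\<close>

lemma not_quadric_pencil:
  assumes e: "klein n = Q1 * G1 + Q2 * G2" and Q: "is_quadric k1 Q1" "is_quadric k2 Q2" and n: "n \<ge> 5"
  shows False
proof (cases "k1 = 0 \<and> k2 = 0")
  case False
  have "klein n = Q2 * G2 + Q1 * G1" using e by (simp add: add.commute)
  thus False using not_quadric_pencil_monic e Q n False by blast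
next
  case True
  obtain p q s a b c d e' g where 1: "Q1 = quadric 0 (lin p q s) (quad a b c d e' g)"
    using Q True unfolding is_quadric_def by blast
  obtain p' q' s' a' b' c' d' e'' g' where 2: "Q2 = quadric 0 (lin p' q' s') (quad a' b' c' d' e'' g')"
    using Q True unfolding is_quadric_def by blast
  let ?r = "quad a b c d e' g" and ?l = "lin p q s" and ?r' = "quad a' b' c' d' e'' g'" and ?l' = "lin p' q' s'"
  have n3: "n \<ge> 3" using n by simp
  have z: "[:klein0 n, X 1 ^ n:] = [:?r, ?l:] * over_z G1 + [:?r', ?l':] * over_z G2"
    using arg_cong[OF e, of over_z] unfolding 1 2 ring_homD(2,3)[OF ring_hom_over_z] over_z_klein over_z_quadric
    by (simp add: C_0)
  hence z': "[:klein0 n, X 1 ^ n:] = [:?r', ?l':] * over_z G2 + [:?r, ?l:] * over_z G1"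
    by (simp add: add.commute)
  show False
  proof (cases "?l dvd ?l'")
    case dvd: True
    show False
    proof (cases "?l = 0")
      case True
      hence "p = 0" "q = 0" "s = 0" by (simp_all add: lin_eq_0_iff)
      hence "klein n = quadric 0 ?l' ?r' * G2 + quadric 0 (lin 0 0 0) ?r * G1" using e 1 2 by (simp add: add.commute)
      thus False using n3 by (rule not_cone_pencil)
    next
      case False
      note pr = lin_dvd_lin[OF dvd]
      have "\<exists>t. p' = t * p \<and> q' = t * q \<and> s' = t * s"
      proof -
        consider "p \<noteq> 0" | "q \<noteq> 0" | "s \<noteq> 0" using False by (auto simp: lin_eq_0_iff)
        thus ?thesis
        proof cases
          case 1 thus ?thesis using pr by (intro exI[of _ "p' / p"]) (auto simp: field_simps)
        next
          case 2 thus ?thesis using pr by (intro exI[of _ "q' / q"]) (auto simp: field_simps)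
        next
          case 3 thus ?thesis using pr by (intro exI[of _ "s' / s"]) (auto simp: field_simps)
        qed
      qed
      then obtain t where t: "p' = t * p" "q' = t * q" "s' = t * s" by blast
      have "Q2 + C (- t) * Q1 = quadric 0 (lin 0 0 0) (?r' + C (- t) * ?r)"
        unfolding 1 2 C_mult_quadric quadric_add C_mult_lin lin_add t by simp
      moreover have "klein n = Q1 * (G1 + C t * G2) + (Q2 + C (- t) * Q1) * G2"
        unfolding e by (simp add: ring_homD[OF ring_hom_C] algebra_simps)
      ultimately show False using not_cone_pencil[OF _ n3] unfolding 1 quad_mult_C quad_add by metis
    qed
  next
    case ndvd: False
    show False
    proof (cases "lin0 p s = 0")
      case False
      thus False using not_linear_pencil[OF z _ refl refl refl refl ndvd] n by simp
    next
      case True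
      hence ps: "p = 0" "s = 0" by (auto simp: lin0_eq_0_iff)
      show False
      proof (cases "q = 0")
        case True
        hence "klein n = quadric 0 ?l' ?r' * G2 + quadric 0 (lin 0 0 0) ?r * G1" using e 1 2 ps by (simp add: add.commute)
        thus False using n3 by (rule not_cone_pencil)
      next
        case q: False
        have "\<not> ?l' dvd ?l"
        proof
          assume "?l' dvd ?l"
          hence "p' = 0" "s' = 0" using lin_dvd_lin[of p' q' s' p q s] ps q by auto
          hence "?l' = C q' * X 1" and "?l = C q * X 1" by (simp_all add: ps lin_def C_0)
          thus False using ndvd C_dvd_iff[OF q, of "X 1" "C q' * X 1"] by (metis dvd_triv_right)
        qed
        moreover have "lin0 p' s' \<noteq> 0"
        proof
          assume "lin0 p' s' = 0"
          hence "p' = 0" "s' = 0" by (auto simp: lin0_eq_0_iff)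
          hence "?l' = C q' * X 1" and "?l = C q * X 1" by (simp_all add: ps lin_def C_0)
          thus False using ndvd C_dvd_iff[OF q, of "X 1" "C q' * X 1"] by (metis dvd_triv_right)
        qed
        ultimately show False using not_linear_pencil[OF z' _ refl refl refl refl] n by simp
      qed
    qed
  qed
qed

section \<open>Forms of degree 2\<close>

lemma is_quadric_monomials:
  assumes "i \<le> 3" "j \<le> 3"
  shows "\<exists>k. is_quadric k (C c * (X i * X j))"
proof -
  have ij: "i \<in> {0, 1, 2, 3}" "j \<in> {0, 1, 2, 3}" using assms by auto
  have l: "is_quadric 0 (C c * (X 2 * lin p q s))" for p q s
  proof -
    have "C c * (X 2 * lin p q s) = quadric 0 (lin (c * p) (c * q) (c * s)) (quad 0 0 0 0 0 0)"
      by (simp add: quadric_def quad_def C_0 C_mult_lin[symmetric] mult_ac)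
    thus ?thesis unfolding is_quadric_def by blast
  qed
  have r: "is_quadric 0 (C c * quad a b e d f g)" for a b e d f g
  proof -
    have "C c * quad a b e d f g = quadric 0 (lin 0 0 0) (quad (c * a) (c * b) (c * e) (c * d) (c * f) (c * g))"
      by (simp add: quadric_def lin_def C_0 quad_mult_C)
    thus ?thesis unfolding is_quadric_def by blast
  qed
  have z: "is_quadric c (C c * (X 2 * X 2))"
  proof -
    have "C c * (X 2 * X 2) = quadric c (lin 0 0 0) (quad 0 0 0 0 0 0)"
      by (simp add: quadric_def lin_def quad_def C_0 power2_eq_square)
    thus ?thesis unfolding is_quadric_def by blast
  qed
  note L = l[of 1 0 0] l[of 0 1 0] l[of 0 0 1]
  note R = r[of 1 0 0 0 0 0] r[of 0 1 0 0 0 0] r[of 0 0 1 0 0 0] r[of 0 0 0 1 0 0] r[of 0 0 0 0 1 0] r[of 0 0 0 0 0 1]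
  show ?thesis using ij z L R
    by (auto simp: lin_def quad_def C_0 C_1 power2_eq_square mult_ac intro: exI[of _ 0] exI[of _ c])
qed

lemma tdeg_eq_0_iff: "tdeg m = 0 \<longleftrightarrow> m = 0"
  by (auto simp: tdeg_def in_keys_iff intro: poly_mapping_eqI)

lemma tdeg_Suc_cases:
  assumes "tdeg m = Suc k"
  obtains i m' where "i \<in> Poly_Mapping.keys m" "m = Poly_Mapping.single i 1 + m'" "tdeg m' = k"
    "Poly_Mapping.keys m' \<subseteq> Poly_Mapping.keys m"
proof -
  have "m \<noteq> 0" using assms by (auto simp: tdeg_eq_0_iff[symmetric])
  then obtain i where i: "i \<in> Poly_Mapping.keys m" by (metis all_not_in_conv keys_eq_empty)
  let ?m' = "m - Poly_Mapping.single i 1"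
  have m: "m = Poly_Mapping.single i 1 + ?m'"
    using i by (intro poly_mapping_eqI) (auto simp: lookup_add lookup_minus lookup_single when_def in_keys_iff)
  have "tdeg m = tdeg (Poly_Mapping.single i 1) + tdeg ?m'" by (subst m) (rule tdeg_add)
  hence "tdeg m = 1 + tdeg ?m'" by (simp add: tdeg_def[of "Poly_Mapping.single i _"])
  moreover have "Poly_Mapping.keys ?m' \<subseteq> Poly_Mapping.keys m" by (auto simp: in_keys_iff lookup_minus)
  ultimately show ?thesis using that[OF i m] assms by simp
qed

lemma form_2_is_quadric:
  assumes "form 3 2 Q"
  shows "\<exists>k. is_quadric k Q"
proof -
  have sum: "\<exists>k. is_quadric k (\<Sum>m\<in>A. f m)" if "\<And>m. m \<in> A \<Longrightarrow> \<exists>k. is_quadric k (f m)"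
    for A :: "(nat \<Rightarrow>\<^sub>0 nat) set" and f
    using that
  proof (induction A rule: infinite_finite_induct)
    case (insert x A)
    thus ?case using is_quadric_add by fastforce
  \<comment> \<open>The empty sum is the monomial x^2 with coefficient 0.\<close>
  qed (use is_quadric_monomials[of 0 0 0] in \<open>simp_all add: C_0\<close>)
  have "\<exists>k. is_quadric k (Poly_Mapping.single m (Poly_Mapping.lookup Q m))" if m: "m \<in> Poly_Mapping.keys Q" for m
  proof -
    have deg: "tdeg m = Suc (Suc 0)" and v: "Poly_Mapping.keys m \<subseteq> {..3}"
      using assms m by (auto simp: form_def homog_def vars_in_def)
    from deg obtain i m' where i: "i \<in> Poly_Mapping.keys m" "m = Poly_Mapping.single i 1 + m'" "tdeg m' = Suc 0"
      "Poly_Mapping.keys m' \<subseteq> Poly_Mapping.keys m" by (rule tdeg_Suc_cases)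
    from i(3) obtain j m'' where j: "j \<in> Poly_Mapping.keys m'" "m' = Poly_Mapping.single j 1 + m''" "tdeg m'' = 0"
      by (rule tdeg_Suc_cases)
    have "m = Poly_Mapping.single i 1 + Poly_Mapping.single j 1" using i j by (simp add: tdeg_eq_0_iff)
    hence "Poly_Mapping.single m (Poly_Mapping.lookup Q m) = C (Poly_Mapping.lookup Q m) * (X i * X j)"
      by (simp add: C_def X_def mult_single)
    moreover have "i \<le> 3" "j \<le> 3" using i j v by auto
    ultimately show ?thesis using is_quadric_monomials by simp
  qed
  hence "\<exists>k. is_quadric k (\<Sum>m\<in>Poly_Mapping.keys Q. Poly_Mapping.single m (Poly_Mapping.lookup Q m))"
    by (rule sum)
  thus ?thesis by (simp only: poly_mapping_eq_sum_single[of Q, symmetric])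
qed

lemma klein_notin_F22:
  assumes "n \<ge> 5"
  shows "klein n \<notin> Fset [2, 2] 3 (Suc n)"
proof
  assume "klein n \<in> Fset [2, 2] 3 (Suc n)"
  then obtain fs gs where f: "\<forall>h<2. form 3 ([2, 2] ! h) (fs ! h)"
    and k: "klein n = (\<Sum>h<2. fs ! h * gs ! h)"
    unfolding Fset_def by (auto simp: numeral_2_eq_2)
  have "form 3 2 (fs ! 0)" "form 3 2 (fs ! 1)" using f[rule_format, of 0] f[rule_format, of 1] by simp_all
  then obtain k1 k2 where "is_quadric k1 (fs ! 0)" "is_quadric k2 (fs ! 1)" using form_2_is_quadric by blast
  moreover have "klein n = fs ! 0 * gs ! 0 + fs ! 1 * gs ! 1" using k by (simp add: numeral_2_eq_2)
  ultimately show False using not_quadric_pencil assms by blast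
qed

theorem theorem6p8:
  fixes d :: nat
  assumes "d \<ge> 6"
  shows "\<exists>f. f \<in> (zar_closure 3 d (Fset [2,2] 3 d) - Fset [2,2] 3 d)
              \<inter> Fset [1,3] 3 d \<inter> Fset [1,1] 3 d"
proof -
  obtain n where n: "d = Suc n" "n \<ge> 5" using assms by (cases d) auto
  thus ?thesis
    using klein_in_closure[of n] klein_notin_F22[of n] klein_in_F13[of n] klein_in_F11[of n]
    by (intro exI[of _ "klein n"]) simp
qed

end
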